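(* Let $S,T$ be orthogonally complete inverse monoids and let $\phi:S\to T$ be an orthogonal join preserving homomorphism. Then there is a homomorphism $K(S)\to K(T)$ (induced by applying $\phi$ entrywise to idempotent matrices, $[E]\mapsto[\phi^{\ast}(E)]$). If $\phi$ is surjective and $\phi^{-1}(0)=\{0\}$, then this homomorphism is surjective.
   Context: Inverse semigroups here have a zero $0$. $E(S)$ is the set of idempotents; $s\leq t$ iff $s=ts^{-1}s$; $s\perp t$ iff $s^{-1}t=0=st^{-1}$. $S$ is orthogonally complete if every pair of orthogonal elements has a join and multiplication distributes over finite orthogonal joins. Idempotents satisfy $e\,\mathcal{D}\,f$ iff there is $s$ with $s^{-1}s=e$, $ss^{-1}=f$. A homomorphism $\phi:S\to T$ (always assumed to satisfy $\phi(0)=0$) is orthogonal join preserving if $s\perp t$ implies $\phi(s\vee t)=\phi(s)\vee\phi(t)$. $M_\omega(S)$ is the set of $\mathbb{N}\times\mathbb{N}$ matrices over $S$ with only finitely many non-zero entries such that $a^{-1}b=0$ for entries $a,b$ in distinct positions of the same row and $ab^{-1}=0$ for entries in distinct positions of the same column, with product $(AB)_{ij}=\bigvee_k a_{ik}b_{kj}$. It is an orthogonally complete inverse semigroup in which for any idempotents $E,F$ there are idempotents $E'\,\mathcal{D}\,E$, $F'\,\mathcal{D}\,F$ with $E'\perp F'$. $A(M_\omega(S))=E(M_\omega(S))/\mathcal{D}$ is a commutative monoid under the well-defined operation $[E]+[F]=[E'\vee F']$, and $K(S)$ is its Grothendieck group. $\phi^{\ast}:M_\omega(S)\to M_\omega(T)$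 is $(\phi^{\ast}(A))_{ij}=\phi(a_{ij})$. *)

theory Defs
  imports "HOL-Algebra.Group"
begin

section \<open>Inverse semigroups with zero\<close>

text \<open>The records \<open>monoid\<close> and \<open>ring\<close> of HOL-Algebra carry a distinguished unit, which the semigroup
  of matrices below does not have; hence a separate record for semigroups with zero.\<close>

record 'a semigroup_zero = "'a partial_object" +
  smult :: "['a, 'a] \<Rightarrow> 'a" (infixl \<open>\<odot>\<index>\<close> 70)
  szero :: 'a (\<open>\<bottom>z\<index>\<close>)

text \<open>The inverse of an element of an inverse semigroup; not to be confused with the group-theoretic
  inverse \<open>m_inv\<close>.\<close>

definition sinv :: "_ \<Rightarrow> 'a \<Rightarrow> 'a" (\<open>sinv\<index> _\<close> [81] 80) where
  "sinv\<^bsub>S\<^esub> s = (THE t. t \<in> carrier S \<and> s \<odot>\<^bsub>S\<^esub> t \<odot>\<^bsub>S\<^esub> s = s \<and> t \<odot>\<^bsub>S\<^esub> s \<odot>\<^bsub>S\<^esub> t = t)"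

locale inverse_semigroup_zero =
  fixes S (structure)
  assumes smult_closed: "\<lbrakk>s \<in> carrier S; t \<in> carrier S\<rbrakk> \<Longrightarrow> s \<odot> t \<in> carrier S"
    and smult_assoc: "\<lbrakk>s \<in> carrier S; t \<in> carrier S; u \<in> carrier S\<rbrakk> \<Longrightarrow> (s \<odot> t) \<odot> u = s \<odot> (t \<odot> u)"
    and inverse_unique:
      "s \<in> carrier S \<Longrightarrow> \<exists>!t. t \<in> carrier S \<and> s \<odot> t \<odot> s = s \<and> t \<odot> s \<odot> t = t"
    and szero_closed: "\<bottom>z \<in> carrier S"
    and szero_left: "s \<in> carrier S \<Longrightarrow> \<bottom>z \<odot> s = \<bottom>z"
    and szero_right: "s \<in> carrier S \<Longrightarrow> s \<odot> \<bottom>z = \<bottom>z"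

definition idempotents :: "_ \<Rightarrow> 'a set" where
  "idempotents S = {e \<in> carrier S. e \<odot>\<^bsub>S\<^esub> e = e}"

text \<open>Joins are the joins \<open>\<squnion>\<close>, \<open>\<Squnion>\<close> of HOL-Algebra for this order.\<close>

definition natural_order :: "_ \<Rightarrow> 'a gorder" where
  "natural_order S = \<lparr>carrier = carrier S, eq = (=), le = (\<lambda>s t. s = t \<odot>\<^bsub>S\<^esub> sinv\<^bsub>S\<^esub> s \<odot>\<^bsub>S\<^esub> s)\<rparr>"

definition orthogonal :: "_ \<Rightarrow> 'a \<Rightarrow> 'a \<Rightarrow> bool" where
  "orthogonal S s t \<longleftrightarrow> sinv\<^bsub>S\<^esub> s \<odot>\<^bsub>S\<^esub> t = \<bottom>z\<^bsub>S\<^esub> \<and> s \<odot>\<^bsub>S\<^esub> sinv\<^bsub>S\<^esub> t = \<bottom>z\<^bsub>S\<^esub>"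

locale orthogonally_complete_inverse_semigroup = inverse_semigroup_zero +
  assumes orthogonal_join_exists:
      "\<lbrakk>s \<in> carrier S; t \<in> carrier S; orthogonal S s t\<rbrakk> \<Longrightarrow> \<exists>x. is_lub (natural_order S) x {s, t}"
    and smult_distrib_left:
      "\<lbrakk>finite A; A \<subseteq> carrier S; pairwise (orthogonal S) A; is_lub (natural_order S) x A;
        u \<in> carrier S\<rbrakk> \<Longrightarrow> is_lub (natural_order S) (u \<odot> x) ((\<lambda>a. u \<odot> a) ` A)"
    and smult_distrib_right:
      "\<lbrakk>finite A; A \<subseteq> carrier S; pairwise (orthogonal S) A; is_lub (natural_order S) x A;
        u \<in> carrier S\<rbrakk> \<Longrightarrow> is_lub (natural_order S) (x \<odot> u) ((\<lambda>a. a \<odot> u) ` A)"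

locale orthogonally_complete_inverse_monoid = orthogonally_complete_inverse_semigroup +
  assumes unit_exists: "\<exists>e\<in>carrier S. \<forall>s\<in>carrier S. e \<odot> s = s \<and> s \<odot> e = s"

text \<open>Homomorphisms preserve multiplication and zero; they are not required to preserve a unit.\<close>

definition szhom :: "_ \<Rightarrow> _ \<Rightarrow> ('a \<Rightarrow> 'b) set" where
  "szhom S T = {\<phi>. \<phi> \<in> carrier S \<rightarrow> carrier T \<and>
     (\<forall>s\<in>carrier S. \<forall>t\<in>carrier S. \<phi> (s \<odot>\<^bsub>S\<^esub> t) = \<phi> s \<odot>\<^bsub>T\<^esub> \<phi> t) \<and> \<phi> \<bottom>z\<^bsub>S\<^esub> = \<bottom>z\<^bsub>T\<^esub>}"

definition orthogonal_join_preserving :: "_ \<Rightarrow> _ \<Rightarrow> ('a \<Rightarrow> 'b) \<Rightarrow> bool" where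
  "orthogonal_join_preserving S T \<phi> \<longleftrightarrow>
     (\<forall>s\<in>carrier S. \<forall>t\<in>carrier S. orthogonal S s t \<longrightarrow>
        \<phi> (s \<squnion>\<^bsub>natural_order S\<^esub> t) = \<phi> s \<squnion>\<^bsub>natural_order T\<^esub> \<phi> t)"


section \<open>The semigroup of matrices\<close>

definition matrices :: "_ \<Rightarrow> (nat \<Rightarrow> nat \<Rightarrow> 'a) semigroup_zero" where
  "matrices S =
    \<lparr>carrier = {A. (\<forall>i j. A i j \<in> carrier S) \<and> finite {(i, j). A i j \<noteq> \<bottom>z\<^bsub>S\<^esub>} \<and>
        (\<forall>i j k. j \<noteq> k \<longrightarrow> sinv\<^bsub>S\<^esub> (A i j) \<odot>\<^bsub>S\<^esub> A i k = \<bottom>z\<^bsub>S\<^esub>) \<and>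
        (\<forall>i j k. i \<noteq> j \<longrightarrow> A i k \<odot>\<^bsub>S\<^esub> sinv\<^bsub>S\<^esub> (A j k) = \<bottom>z\<^bsub>S\<^esub>)},
     smult = (\<lambda>A B i j. \<Squnion>\<^bsub>natural_order S\<^esub> (range (\<lambda>k. A i k \<odot>\<^bsub>S\<^esub> B k j))),
     szero = (\<lambda>i j. \<bottom>z\<^bsub>S\<^esub>)\<rparr>"

definition map_matrix :: "('a \<Rightarrow> 'b) \<Rightarrow> (nat \<Rightarrow> nat \<Rightarrow> 'a) \<Rightarrow> nat \<Rightarrow> nat \<Rightarrow> 'b" where
  "map_matrix \<phi> A = (\<lambda>i j. \<phi> (A i j))"


section \<open>The monoid of classes of idempotents and its Grothendieck group\<close>

definition D_rel :: "_ \<Rightarrow> ('a \<times> 'a) set" where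
  "D_rel S = {(e, f). e \<in> idempotents S \<and> f \<in> idempotents S \<and>
     (\<exists>s\<in>carrier S. sinv\<^bsub>S\<^esub> s \<odot>\<^bsub>S\<^esub> s = e \<and> s \<odot>\<^bsub>S\<^esub> sinv\<^bsub>S\<^esub> s = f)}"

text \<open>The sum of two classes \<open>X\<close>, \<open>Y\<close> is the class of \<open>E \<squnion> F\<close> for any orthogonal \<open>E \<in> X\<close>, \<open>F \<in> Y\<close>. As
  usual for quotients, it is written as the union over all admissible choices, all of which yield
  the same class when \<open>M\<close> is orthogonally complete; for \<open>M = matrices S\<close> a choice always exists. The
  commutative monoid is, as everywhere in HOL-Algebra, written multiplicatively.\<close>

definition idempotent_classes :: "_ \<Rightarrow> 'a set monoid" where
  "idempotent_classes M =
    \<lparr>carrier = idempotents M // D_rel M,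
     mult = (\<lambda>X Y. \<Union>E\<in>X. \<Union>F\<in>{F \<in> Y. orthogonal M E F}.
        D_rel M `` {E \<squnion>\<^bsub>natural_order M\<^esub> F}),
     one = D_rel M `` {\<bottom>z\<^bsub>M\<^esub>}\<rparr>"

text \<open>The Grothendieck group of a commutative monoid, as formal differences \<open>(a, b)\<close> of \<open>a\<close> and \<open>b\<close>.\<close>

definition grothendieck_rel :: "_ \<Rightarrow> (('a \<times> 'a) \<times> ('a \<times> 'a)) set" where
  "grothendieck_rel G = {((a, b), (c, d)). a \<in> carrier G \<and> b \<in> carrier G \<and> c \<in> carrier G \<and>
     d \<in> carrier G \<and> (\<exists>k\<in>carrier G. a \<otimes>\<^bsub>G\<^esub> d \<otimes>\<^bsub>G\<^esub> k = c \<otimes>\<^bsub>G\<^esub> b \<otimes>\<^bsub>G\<^esub> k)}"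

definition grothendieck_group :: "_ \<Rightarrow> ('a \<times> 'a) set monoid" where
  "grothendieck_group G =
    \<lparr>carrier = (carrier G \<times> carrier G) // grothendieck_rel G,
     mult = (\<lambda>X Y. \<Union>(a, b)\<in>X. \<Union>(c, d)\<in>Y. grothendieck_rel G `` {(a \<otimes>\<^bsub>G\<^esub> c, b \<otimes>\<^bsub>G\<^esub> d)}),
     one = grothendieck_rel G `` {(\<one>\<^bsub>G\<^esub>, \<one>\<^bsub>G\<^esub>)}\<rparr>"

definition K_group ::
  "_ \<Rightarrow> ((nat \<Rightarrow> nat \<Rightarrow> 'a) set \<times> (nat \<Rightarrow> nat \<Rightarrow> 'a) set) set monoid" where
  "K_group S = grothendieck_group (idempotent_classes (matrices S))"

text \<open>The element \<open>[E]\<close> of \<open>K(S)\<close>, i.e. the image of the \<open>\<D>\<close>-class of \<open>E\<close> under the canonical map into the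
  Grothendieck group.\<close>

definition K_class ::
  "_ \<Rightarrow> (nat \<Rightarrow> nat \<Rightarrow> 'a) \<Rightarrow> ((nat \<Rightarrow> nat \<Rightarrow> 'a) set \<times> (nat \<Rightarrow> nat \<Rightarrow> 'a) set) set" where
  "K_class S E = grothendieck_rel (idempotent_classes (matrices S)) ``
     {(D_rel (matrices S) `` {E}, \<one>\<^bsub>idempotent_classes (matrices S)\<^esub>)}"

end

theory Submission
  imports Defs
begin

text \<open>
  Everything is reduced to two functors. The first sends an inverse semigroup \<open>S\<close> with finite
  orthogonal joins to the commutative monoid of \<open>\<D>\<close>-classes of its idempotents, provided that any
  idempotent has a \<open>\<D>\<close>-equivalent copy orthogonal to a given idempotent; the second is the Grothendieck
  group. A homomorphism that preserves orthogonal joins preserves inverses, hence idempotents,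
  orthogonality and \<open>\<D>\<close>, and so acts on both. What remains is to see that matrices over \<open>S\<close> are a
  legitimate argument for the first functor, and that the entrywise map \<open>\<phi>\<^sup>*\<close> is a homomorphism of
  matrix semigroups preserving orthogonal joins.

  For the matrices the difficulty is that the inverse has to be unique. The candidate for the inverse of
  \<open>A\<close> is the adjoint \<open>A\<^sup>*\<close>, the transpose of the entrywise inverse: the row and column
  conditions kill all terms of \<open>A A\<^sup>* A\<close> except the one that gives back \<open>A\<close>, and they make
  \<open>A\<^sup>* A\<close> diagonal. If \<open>E\<close> is idempotent, then so is \<open>E\<^sup>*\<close>, and
  \<open>E = E E\<^sup>* E = (E E\<^sup>*) (E\<^sup>* E)\<close> is a product of two diagonal matrices
  (\<open>idempotent_matrix_diagonal\<close>). So the idempotents are the diagonal matrices with idempotent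
  entries; they commute because those of \<open>S\<close> do, and a regular semigroup with commuting
  idempotents is inverse (\<open>inverse_semigroup_matrices\<close>). The natural order of matrices turns out to
  be entrywise (\<open>nle_matrix_iff\<close>), so orthogonal joins exist and distribute because they do in
  \<open>S\<close> (\<open>orthogonally_complete_matrices\<close>). Room for orthogonal copies is made by shifting a
  matrix down the diagonal (\<open>orthogonal_copy_exists\<close>).

  For surjectivity, an idempotent matrix over \<open>T\<close> is diagonal with idempotent entries
  \<open>f = \<phi> s\<close>. Each of them is the image of the idempotent \<open>s\<^sup>-\<^sup>1 s\<close>, and choosing \<open>0\<close> above \<open>0\<close>
  keeps the support finite. Thus \<open>\<phi>\<^sup>*\<close> is already onto on idempotent matrices
  (\<open>map_matrix_idempotents_surj\<close>), hence on classes and on formal differences.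
\<close>

section \<open>Inverse semigroups with zero\<close>

abbreviation lub :: "_ \<Rightarrow> 'a \<Rightarrow> 'a set \<Rightarrow> bool" where
  "lub S \<equiv> is_lub (natural_order S)"

context inverse_semigroup_zero
begin

abbreviation nle (infix "\<preceq>" 50) where "s \<preceq> t \<equiv> s \<sqsubseteq>\<^bsub>natural_order S\<^esub> t"

declare smult_closed [simp] szero_closed [simp] szero_left [simp] szero_right [simp]

lemma sinv_spec:
  assumes "s \<in> carrier S"
  shows "sinv s \<in> carrier S \<and> s \<odot> sinv s \<odot> s = s \<and> sinv s \<odot> s \<odot> sinv s = sinv s"
  unfolding sinv_def by (rule theI'[OF inverse_unique[OF assms]])

lemma sinv_closed [simp]: "s \<in> carrier S \<Longrightarrow> sinv s \<in> carrier S"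
  using sinv_spec by blast

lemma sinv_cancel [simp]:
  "s \<in> carrier S \<Longrightarrow> s \<odot> (sinv s \<odot> s) = s"
  "s \<in> carrier S \<Longrightarrow> sinv s \<odot> (s \<odot> sinv s) = sinv s"
  using sinv_spec[of s] by (auto simp: smult_assoc)

lemma sinv_cancel_assoc [simp]:
  "\<lbrakk>s \<in> carrier S; t \<in> carrier S\<rbrakk> \<Longrightarrow> s \<odot> (sinv s \<odot> (s \<odot> t)) = s \<odot> t"
  "\<lbrakk>s \<in> carrier S; t \<in> carrier S\<rbrakk> \<Longrightarrow> sinv s \<odot> (s \<odot> (sinv s \<odot> t)) = sinv s \<odot> t"
  by (metis sinv_cancel sinv_closed smult_assoc smult_closed)+

lemma sinv_eqI:
  assumes "s \<in> carrier S" "t \<in> carrier S" "s \<odot> (t \<odot> s) = s" "t \<odot> (s \<odot> t) = t"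
  shows "sinv s = t"
  using inverse_unique[OF assms(1)] sinv_spec[OF assms(1)] assms by (metis smult_assoc)

lemma sinv_sinv [simp]: "s \<in> carrier S \<Longrightarrow> sinv (sinv s) = s"
  by (rule sinv_eqI) auto

lemma sinv_zero [simp]: "sinv \<bottom>z = \<bottom>z"
  by (rule sinv_eqI) auto

lemma idempotentD:
  "e \<in> idempotents S \<Longrightarrow> e \<in> carrier S" "e \<in> idempotents S \<Longrightarrow> e \<odot> e = e"
  by (auto simp: idempotents_def)

lemma idempotentI: "e \<in> carrier S \<Longrightarrow> e \<odot> e = e \<Longrightarrow> e \<in> idempotents S"
  by (auto simp: idempotents_def)

lemma idempotent_square_assoc:
  "e \<in> idempotents S \<Longrightarrow> t \<in> carrier S \<Longrightarrow> e \<odot> (e \<odot> t) = e \<odot> t"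
  by (metis idempotentD smult_assoc)

lemma sinv_idempotent [simp]: "e \<in> idempotents S \<Longrightarrow> sinv e = e"
  by (rule sinv_eqI) (auto simp: idempotentD)

lemma zero_idempotent [simp]: "\<bottom>z \<in> idempotents S"
  by (simp add: idempotentI)

text \<open>With \<open>x\<close> the inverse of \<open>e f\<close>, the element \<open>f x e\<close> is also an inverse of \<open>e f\<close>, so \<open>x = f x e\<close>; this
makes \<open>x\<close> idempotent, and an idempotent is its own inverse.\<close>

lemma idempotent_mult_idempotent:
  assumes e: "e \<in> idempotents S" and f: "f \<in> idempotents S"
  shows "e \<odot> f \<in> idempotents S"
proof -
  note [simp] = idempotentD[OF e] idempotentD[OF f] idempotent_square_assoc[OF e]
    idempotent_square_assoc[OF f] smult_assoc
  define x where "x = sinv (e \<odot> f)"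
  have x [simp]: "x \<in> carrier S" by (simp add: x_def)
  have x1: "e \<odot> (f \<odot> (x \<odot> (e \<odot> f))) = e \<odot> f"
    using sinv_cancel(1)[of "e \<odot> f", folded x_def] by simp
  have x2: "x \<odot> (e \<odot> (f \<odot> x)) = x"
    using sinv_cancel(2)[of "e \<odot> f", folded x_def] by simp
  have x2': "x \<odot> (e \<odot> (f \<odot> (x \<odot> e))) = x \<odot> e"
    using arg_cong[OF x2, of "\<lambda>y. y \<odot> e"] by simp
  have "sinv (e \<odot> f) = f \<odot> (x \<odot> e)"
    by (rule sinv_eqI) (auto simp: x1 x2')
  then have fxe: "f \<odot> (x \<odot> e) = x" by (simp add: x_def)
  have "x \<odot> x = f \<odot> (x \<odot> e) \<odot> (f \<odot> (x \<odot> e))" by (simp only: fxe)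
  also have "\<dots> = f \<odot> (x \<odot> e)" by (simp add: x2')
  finally have "x \<in> idempotents S" by (simp add: fxe idempotentI)
  then have "sinv x = x" by simp
  then have "x = e \<odot> f" by (simp add: x_def)
  with \<open>x \<in> idempotents S\<close> show ?thesis by simp
qed

text \<open>Both \<open>e f\<close> and \<open>f e\<close> are inverses of the idempotent \<open>e f\<close>.\<close>

lemma idempotents_commute:
  assumes e: "e \<in> idempotents S" and f: "f \<in> idempotents S"
  shows "e \<odot> f = f \<odot> e"
proof -
  note [simp] = idempotentD[OF e] idempotentD[OF f] idempotent_square_assoc[OF e]
    idempotent_square_assoc[OF f] smult_assoc
  note ef = idempotent_mult_idempotent[OF e f] and fe = idempotent_mult_idempotent[OF f e]
  have "sinv (e \<odot> f) = f \<odot> e"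
    by (rule sinv_eqI) (use idempotentD(2)[OF ef] idempotentD(2)[OF fe] in auto)
  then show ?thesis using ef by simp
qed

lemma domain_idempotent [simp]: "s \<in> carrier S \<Longrightarrow> sinv s \<odot> s \<in> idempotents S"
  by (rule idempotentI) (auto simp: smult_assoc)

lemma range_idempotent [simp]: "s \<in> carrier S \<Longrightarrow> s \<odot> sinv s \<in> idempotents S"
  by (rule idempotentI) (auto simp: smult_assoc)

lemma sinv_mult:
  assumes [simp]: "s \<in> carrier S" "t \<in> carrier S"
  shows "sinv (s \<odot> t) = sinv t \<odot> sinv s"
proof (rule sinv_eqI)
  have c: "sinv s \<odot> s \<odot> (t \<odot> sinv t) = t \<odot> sinv t \<odot> (sinv s \<odot> s)"
    by (rule idempotents_commute) auto
  have "s \<odot> t \<odot> (sinv t \<odot> sinv s \<odot> (s \<odot> t)) = s \<odot> (t \<odot> sinv t \<odot> (sinv s \<odot> s)) \<odot> t"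
    by (simp add: smult_assoc)
  then show "s \<odot> t \<odot> (sinv t \<odot> sinv s \<odot> (s \<odot> t)) = s \<odot> t"
    by (simp only: c [symmetric]) (simp add: smult_assoc)
  have "sinv t \<odot> sinv s \<odot> (s \<odot> t \<odot> (sinv t \<odot> sinv s)) =
      sinv t \<odot> (sinv s \<odot> s \<odot> (t \<odot> sinv t)) \<odot> sinv s"
    by (simp add: smult_assoc)
  then show "sinv t \<odot> sinv s \<odot> (s \<odot> t \<odot> (sinv t \<odot> sinv s)) = sinv t \<odot> sinv s"
    by (simp only: c) (simp add: smult_assoc)
qed auto

lemma conj_idempotent:
  assumes e: "e \<in> idempotents S" and [simp]: "s \<in> carrier S"
  shows "s \<odot> (e \<odot> sinv s) \<in> idempotents S"
proof (rule idempotentI)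
  note [simp] = idempotentD[OF e]
  have "s \<odot> (e \<odot> sinv s) \<odot> (s \<odot> (e \<odot> sinv s)) = s \<odot> (e \<odot> (sinv s \<odot> s)) \<odot> (e \<odot> sinv s)"
    by (simp add: smult_assoc)
  also have "\<dots> = s \<odot> (e \<odot> sinv s)"
    by (subst idempotents_commute) (auto simp: e smult_assoc idempotent_square_assoc)
  finally show "s \<odot> (e \<odot> sinv s) \<odot> (s \<odot> (e \<odot> sinv s)) = s \<odot> (e \<odot> sinv s)" .
qed (simp add: idempotentD[OF e])

text \<open>Allows an idempotent to be moved from one side of an element to the other.\<close>

lemma mult_idempotent_eq_conj_mult:
  assumes e: "e \<in> idempotents S" and [simp]: "s \<in> carrier S"
  shows "s \<odot> e = s \<odot> (e \<odot> sinv s) \<odot> s"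
proof -
  note [simp] = idempotentD[OF e]
  have "s \<odot> (e \<odot> sinv s) \<odot> s = s \<odot> (e \<odot> (sinv s \<odot> s))" by (simp add: smult_assoc)
  also have "\<dots> = s \<odot> e" by (subst idempotents_commute) (auto simp: e smult_assoc)
  finally show ?thesis by simp
qed

section \<open>The natural order\<close>

lemma carrier_natural_order [simp]: "carrier (natural_order S) = carrier S"
  by (simp add: natural_order_def)

lemma nle_def: "s \<preceq> t \<longleftrightarrow> s = t \<odot> sinv s \<odot> s"
  by (simp add: natural_order_def)

lemma mult_idempotent_nle:
  assumes e: "e \<in> idempotents S" and [simp]: "t \<in> carrier S"
  shows "t \<odot> e \<preceq> t"
proof -
  note [simp] = idempotentD[OF e]
  have "t \<odot> sinv (t \<odot> e) \<odot> (t \<odot> e) = t \<odot> (e \<odot> (sinv t \<odot> t) \<odot> e)"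
    by (simp add: sinv_mult e smult_assoc)
  also have "e \<odot> (sinv t \<odot> t) \<odot> e = sinv t \<odot> t \<odot> e"
    by (subst idempotents_commute) (auto simp: e smult_assoc)
  finally show ?thesis by (simp add: nle_def smult_assoc)
qed

lemma idempotent_mult_nle:
  assumes e: "e \<in> idempotents S" and [simp]: "t \<in> carrier S"
  shows "e \<odot> t \<preceq> t"
proof -
  note [simp] = idempotentD[OF e]
  have "e \<odot> t = e \<odot> (t \<odot> sinv t) \<odot> t" by (simp add: smult_assoc)
  also have "e \<odot> (t \<odot> sinv t) = t \<odot> sinv t \<odot> e" by (rule idempotents_commute) (auto simp: e)
  finally have "e \<odot> t = t \<odot> (sinv t \<odot> (e \<odot> t))" by (simp add: smult_assoc)
  moreover have "sinv t \<odot> (e \<odot> t) \<in> idempotents S"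
    using conj_idempotent[of e "sinv t"] e by simp
  ultimately show ?thesis using mult_idempotent_nle by (metis assms(2))
qed

lemma nleE:
  assumes "s \<preceq> t" and [simp]: "s \<in> carrier S" "t \<in> carrier S"
  obtains e where "e \<in> idempotents S" "s = t \<odot> e"
  using assms domain_idempotent[of s] unfolding nle_def
  by (metis assms(2) sinv_closed smult_assoc)

lemma nle_leftE:
  assumes "s \<preceq> t" and [simp]: "s \<in> carrier S" "t \<in> carrier S"
  obtains e where "e \<in> idempotents S" "s = e \<odot> t"
  using nleE[OF assms] conj_idempotent mult_idempotent_eq_conj_mult by (metis assms(3))

sublocale natural: partial_order "natural_order S"
proof
  fix s t u assume c [simp]: "s \<in> carrier (natural_order S)" "t \<in> carrier (natural_order S)"
    "u \<in> carrier (natural_order S)"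
  note [simp] = c[simplified]
  show "s \<preceq> u" if "s \<preceq> t" "t \<preceq> u"
  proof -
    obtain e where e: "e \<in> idempotents S" "s = t \<odot> e" using \<open>s \<preceq> t\<close> by (rule nleE) auto
    obtain f where f: "f \<in> idempotents S" "t = u \<odot> f" using \<open>t \<preceq> u\<close> by (rule nleE) auto
    have "s = u \<odot> (f \<odot> e)" using e f by (simp add: smult_assoc idempotentD)
    then show ?thesis
      using mult_idempotent_nle[OF idempotent_mult_idempotent[OF f(1) e(1)]] by simp
  qed
next
  fix s t assume c [simp]: "s \<in> carrier (natural_order S)" "t \<in> carrier (natural_order S)"
  note [simp] = c[simplified]
  assume "s \<preceq> t" "t \<preceq> s"
  obtain e where e: "e \<in> idempotents S" "s = t \<odot> e" using \<open>s \<preceq> t\<close> by (rule nleE) auto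
  obtain f where f: "f \<in> idempotents S" "t = s \<odot> f" using \<open>t \<preceq> s\<close> by (rule nleE) auto
  note [simp] = idempotentD[OF e(1)] idempotentD[OF f(1)]
  have "s \<odot> e = s" using e(2) by (simp add: smult_assoc)
  have "s = s \<odot> f \<odot> e" using e(2) f(2) by metis
  also have "\<dots> = s \<odot> e \<odot> f" using idempotents_commute[OF e(1) f(1)] by (simp add: smult_assoc)
  also have "\<dots> = t" using \<open>s \<odot> e = s\<close> f(2) by metis
  finally have "s = t" .
  then show "s .=\<^bsub>natural_order S\<^esub> t" by (simp add: natural_order_def)
qed (auto simp: nle_def natural_order_def smult_assoc)

lemma zero_nle [simp]: "s \<in> carrier S \<Longrightarrow> \<bottom>z \<preceq> s"
  by (simp add: nle_def)

lemma sinv_mono: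
  assumes "s \<preceq> t" and [simp]: "s \<in> carrier S" "t \<in> carrier S"
  shows "sinv s \<preceq> sinv t"
proof -
  obtain e where "e \<in> idempotents S" "s = e \<odot> t" using assms(1-3) by (rule nle_leftE)
  then show ?thesis using mult_idempotent_nle[of e "sinv t"] by (simp add: sinv_mult idempotentD)
qed

lemma lubI:
  assumes "x \<in> carrier S" "\<And>a. a \<in> A \<Longrightarrow> a \<preceq> x"
    and "\<And>u. \<lbrakk>u \<in> carrier S; \<And>a. a \<in> A \<Longrightarrow> a \<preceq> u\<rbrakk> \<Longrightarrow> x \<preceq> u" "A \<subseteq> carrier S"
  shows "lub S x A"
  using assms(1,2,4) by (auto simp: least_def Upper_def intro!: assms(3))

lemma lub_closed: "lub S x A \<Longrightarrow> x \<in> carrier S"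
  unfolding least_def Upper_def by auto

lemma lub_upper: "\<lbrakk>lub S x A; a \<in> A; A \<subseteq> carrier S\<rbrakk> \<Longrightarrow> a \<preceq> x"
  unfolding least_def Upper_def by auto

lemma lub_least: "\<lbrakk>lub S x A; u \<in> carrier S; \<And>a. a \<in> A \<Longrightarrow> a \<preceq> u\<rbrakk> \<Longrightarrow> x \<preceq> u"
  unfolding least_def Upper_def by auto

lemma lub_unique: "lub S x A \<Longrightarrow> lub S y A \<Longrightarrow> x = y"
  by (rule natural.least_unique)

lemma Join_eq: "lub S x A \<Longrightarrow> \<Squnion>\<^bsub>natural_order S\<^esub> A = x"
  unfolding sup_def using lub_unique by (metis someI)

lemma join_eq: "lub S x {s, t} \<Longrightarrow> s \<squnion>\<^bsub>natural_order S\<^esub> t = x"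
  by (simp add: join_def Join_eq)

lemma lub_zero: "lub S x A \<Longrightarrow> A \<subseteq> {\<bottom>z} \<Longrightarrow> x = \<bottom>z"
  by (rule lub_unique) (auto intro!: lubI)

lemma lub_max: "a \<in> A \<Longrightarrow> A \<subseteq> carrier S \<Longrightarrow> (\<And>b. b \<in> A \<Longrightarrow> b \<preceq> a) \<Longrightarrow> lub S a A"
  by (rule lubI) auto

text \<open>Iterated joins are joins of unions. Because this holds for joins in the sense of least upper bounds,
without any existence assumption, double joins can be interchanged freely: the two iterated joins of a
doubly indexed family are joins of the same set.\<close>

lemma lub_UN:
  assumes A: "\<And>i. i \<in> I \<Longrightarrow> A i \<subseteq> carrier S" and f: "\<And>i. i \<in> I \<Longrightarrow> lub S (f i) (A i)"
  shows "lub S x (f ` I) \<longleftrightarrow> lub S x (\<Union>i\<in>I. A i)"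
proof -
  have "Upper (natural_order S) (f ` I) = Upper (natural_order S) (\<Union>i\<in>I. A i)"
  proof (intro Set.set_eqI iffI)
    fix u assume u: "u \<in> Upper (natural_order S) (f ` I)"
    have "a \<preceq> u" if "i \<in> I" "a \<in> A i" for a i
    proof -
      have "f i \<preceq> u" using u that lub_closed[OF f] by (auto simp: Upper_def)
      moreover have "a \<preceq> f i" using that by (intro lub_upper[OF f] A)
      moreover have "a \<in> carrier S" "f i \<in> carrier S" "u \<in> carrier S"
        using that A lub_closed[OF f] u by (auto simp: Upper_def)
      ultimately show ?thesis using natural.le_trans[of a "f i" u] by simp
    qed
    then show "u \<in> Upper (natural_order S) (\<Union>i\<in>I. A i)" using u by (auto simp: Upper_def)
  next
    fix u assume u: "u \<in> Upper (natural_order S) (\<Union>i\<in>I. A i)"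
    have "f i \<preceq> u" if "i \<in> I" for i
      by (rule lub_least[OF f]) (use u that A[OF that] in \<open>auto simp: Upper_def subset_iff\<close>)
    then show "u \<in> Upper (natural_order S) (f ` I)" using u by (auto simp: Upper_def)
  qed
  then show ?thesis by simp
qed

lemma lub_insert:
  assumes x: "lub S x A" and A: "A \<subseteq> carrier S" "a \<in> carrier S"
  shows "lub S y {a, x} \<longleftrightarrow> lub S y (insert a A)"
proof -
  have "lub S y ((\<lambda>b. if b then a else x) ` UNIV) \<longleftrightarrow> lub S y (\<Union>b\<in>UNIV. if b then {a} else A)"
    by (rule lub_UN) (use A x in \<open>auto intro: lub_max\<close>)
  then show ?thesis by (simp add: UNIV_bool insert_commute)
qed

lemma lub_sinv:
  assumes x: "lub S x A" and A: "A \<subseteq> carrier S"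
  shows "lub S (sinv x) ((\<lambda>a. sinv a) ` A)"
proof (rule lubI)
  note [simp] = lub_closed[OF x]
  show "b \<preceq> sinv x" if "b \<in> (\<lambda>a. sinv a) ` A" for b
    using that lub_upper[OF x _ A] A by (auto intro!: sinv_mono)
  show "sinv x \<preceq> u" if u [simp]: "u \<in> carrier S" "\<And>a. a \<in> (\<lambda>a. sinv a) ` A \<Longrightarrow> a \<preceq> u" for u
  proof -
    have "x \<preceq> sinv u"
    proof (rule lub_least[OF x])
      fix a assume "a \<in> A"
      then show "a \<preceq> sinv u" using sinv_mono[of "sinv a" u] A u(2)[of "sinv a"] by auto
    qed auto
    then show ?thesis using sinv_mono[of x "sinv u"] by simp
  qed
qed (use A lub_closed[OF x] in auto)

section \<open>Orthogonality\<close>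

lemma orthogonal_sym:
  assumes [simp]: "s \<in> carrier S" "t \<in> carrier S"
  shows "orthogonal S s t \<longleftrightarrow> orthogonal S t s"
proof -
  have "sinv s \<odot> t = \<bottom>z \<longleftrightarrow> sinv t \<odot> s = \<bottom>z"
    if [simp]: "s \<in> carrier S" "t \<in> carrier S" for s t
    using sinv_mult[of "sinv s" t] sinv_mult[of "sinv t" s] by auto
  moreover have "s \<odot> sinv t = \<bottom>z \<longleftrightarrow> t \<odot> sinv s = \<bottom>z"
    using sinv_mult[of s "sinv t"] sinv_mult[of t "sinv s"] by auto
  ultimately show ?thesis by (auto simp: orthogonal_def)
qed

lemma orthogonal_zero [simp]: "s \<in> carrier S \<Longrightarrow> orthogonal S s \<bottom>z"
  "s \<in> carrier S \<Longrightarrow> orthogonal S \<bottom>z s"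
  by (auto simp: orthogonal_def)

lemma orthogonal_idempotents:
  "\<lbrakk>e \<in> idempotents S; f \<in> idempotents S\<rbrakk> \<Longrightarrow> orthogonal S e f \<longleftrightarrow> e \<odot> f = \<bottom>z"
  by (simp add: orthogonal_def)

text \<open>The idempotent commutes with \<open>s s\<^sup>-\<^sup>1\<close>, so it can be moved out of the way of \<open>s\<^sup>-\<^sup>1 t\<close>.\<close>

lemma mult_zero_insert_idempotent:
  assumes e: "e \<in> idempotents S" and [simp]: "s \<in> carrier S" "t \<in> carrier S"
    and z: "sinv s \<odot> t = \<bottom>z"
  shows "sinv s \<odot> (e \<odot> t) = \<bottom>z"
proof -
  note [simp] = idempotentD[OF e]
  have "sinv s \<odot> (e \<odot> t) = sinv s \<odot> (s \<odot> sinv s \<odot> e) \<odot> t"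
    by (simp add: smult_assoc)
  also have "s \<odot> sinv s \<odot> e = e \<odot> (s \<odot> sinv s)" by (rule idempotents_commute) (auto simp: e)
  finally show ?thesis by (simp add: smult_assoc z)
qed

end

context orthogonally_complete_inverse_semigroup
begin

lemma lub_mult_zero_left:
  assumes "finite A" "A \<subseteq> carrier S" "pairwise (orthogonal S) A" "lub S x A" "u \<in> carrier S"
    and "\<And>a. a \<in> A \<Longrightarrow> u \<odot> a = \<bottom>z"
  shows "u \<odot> x = \<bottom>z"
  using smult_distrib_left[OF assms(1-5)] by (rule lub_zero) (use assms(6) in auto)

lemma lub_mult_zero_right:
  assumes "finite A" "A \<subseteq> carrier S" "pairwise (orthogonal S) A" "lub S x A" "u \<in> carrier S"
    and "\<And>a. a \<in> A \<Longrightarrow> a \<odot> u = \<bottom>z"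
  shows "x \<odot> u = \<bottom>z"
  using smult_distrib_right[OF assms(1-5)] by (rule lub_zero) (use assms(6) in auto)

lemma pairwise_orthogonal_sinv:
  assumes "A \<subseteq> carrier S" "pairwise (orthogonal S) A"
  shows "pairwise (orthogonal S) ((\<lambda>a. sinv a) ` A)"
  unfolding pairwise_def
proof (intro ballI impI)
  fix b c assume "b \<in> (\<lambda>a. sinv a) ` A" "c \<in> (\<lambda>a. sinv a) ` A" "b \<noteq> c"
  then obtain s t where st: "s \<in> A" "t \<in> A" "b = sinv s" "c = sinv t" "s \<noteq> t" by auto
  then have "orthogonal S s t" using assms by (auto simp: pairwise_def)
  then show "orthogonal S b c" using st assms by (auto simp: orthogonal_def)
qed

lemma lub_mult_lub_zero:
  assumes A: "finite A" "A \<subseteq> carrier S" "pairwise (orthogonal S) A" "lub S x A"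
    and B: "finite B" "B \<subseteq> carrier S" "pairwise (orthogonal S) B" "lub S y B"
    and "\<And>a b. \<lbrakk>a \<in> A; b \<in> B\<rbrakk> \<Longrightarrow> sinv a \<odot> b = \<bottom>z"
  shows "sinv x \<odot> y = \<bottom>z"
proof (rule lub_mult_zero_right)
  show "lub S (sinv x) ((\<lambda>a. sinv a) ` A)" using A by (simp add: lub_sinv)
  fix a' assume "a' \<in> (\<lambda>a. sinv a) ` A"
  then obtain a where a: "a \<in> A" "a' = sinv a" by auto
  show "a' \<odot> y = \<bottom>z" using B by (rule lub_mult_zero_left) (use a A assms(9) in auto)
qed (use A B(4) pairwise_orthogonal_sinv lub_closed in auto)

lemma orthogonal_lub:
  assumes A: "finite A" "A \<subseteq> carrier S" "pairwise (orthogonal S) A" "lub S x A"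
    and [simp]: "u \<in> carrier S" and o: "\<And>a. a \<in> A \<Longrightarrow> orthogonal S u a"
  shows "orthogonal S u x"
  unfolding orthogonal_def
proof
  show "sinv u \<odot> x = \<bottom>z"
    using A by (rule lub_mult_zero_left) (use o in \<open>auto simp: orthogonal_def\<close>)
  show "u \<odot> sinv x = \<bottom>z"
  proof (rule lub_mult_zero_left)
    show "lub S (sinv x) ((\<lambda>a. sinv a) ` A)" using A by (simp add: lub_sinv)
  qed (use A o pairwise_orthogonal_sinv in \<open>auto simp: orthogonal_def\<close>)
qed

text \<open>Induction over the set: distributivity makes a further element that is orthogonal to all members of
\<open>A\<close> orthogonal to the join of \<open>A\<close>, so only binary joins are needed.\<close>

lemma finite_orthogonal_lub_exists:
  assumes "finite A" "A \<subseteq> carrier S" "pairwise (orthogonal S) A"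
  shows "\<exists>x. lub S x A"
  using assms
proof (induction A)
  case empty
  have "lub S \<bottom>z {}" by (rule lubI) auto
  then show ?case by blast
next
  case (insert a A)
  then have A: "finite A" "A \<subseteq> carrier S" "pairwise (orthogonal S) A" and [simp]: "a \<in> carrier S"
    and o: "\<And>b. b \<in> A \<Longrightarrow> orthogonal S a b"
    by (auto simp: pairwise_insert)
  from insert.IH[OF A(2,3)] obtain x where x: "lub S x A" by blast
  have "orthogonal S a x"
    by (rule orthogonal_lub[OF A x _ o]) auto
  then obtain y where y: "lub S y {a, x}"
    using orthogonal_join_exists[of a x] lub_closed[OF x] by auto
  then show ?case using lub_insert[OF x A(2)] by auto
qed

lemma lub_Join:
  assumes "finite A" "A \<subseteq> carrier S" "pairwise (orthogonal S) A"
  shows "lub S (\<Squnion>\<^bsub>natural_order S\<^esub> A) A"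
  using finite_orthogonal_lub_exists[OF assms] Join_eq by auto

end

section \<open>The semigroup of matrices\<close>

context orthogonally_complete_inverse_semigroup
begin

text \<open>The inverse of \<open>A\<close> in the semigroup of matrices, as \<open>sinv_matrix\<close> will show.\<close>

definition adjoint :: "(nat \<Rightarrow> nat \<Rightarrow> 'a) \<Rightarrow> nat \<Rightarrow> nat \<Rightarrow> 'a" where
  "adjoint A = (\<lambda>i j. sinv (A j i))"

abbreviation mmult (infixl "\<cdot>" 70) where "A \<cdot> B \<equiv> A \<odot>\<^bsub>matrices S\<^esub> B"

lemma adjoint_apply [simp]: "adjoint A i j = sinv (A j i)"
  by (simp add: adjoint_def)

lemma matrix_iff:
  "A \<in> carrier (matrices S) \<longleftrightarrow>
    (\<forall>i j. A i j \<in> carrier S) \<and> finite {(i, j). A i j \<noteq> \<bottom>z} \<and>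
    (\<forall>i j k. j \<noteq> k \<longrightarrow> sinv (A i j) \<odot> A i k = \<bottom>z) \<and>
    (\<forall>i j k. i \<noteq> j \<longrightarrow> A i k \<odot> sinv (A j k) = \<bottom>z)"
  by (simp add: matrices_def)

lemma matrix_entry [simp]: "A \<in> carrier (matrices S) \<Longrightarrow> A i j \<in> carrier S"
  by (simp add: matrix_iff)

lemma matrix_row: "A \<in> carrier (matrices S) \<Longrightarrow> j \<noteq> k \<Longrightarrow> sinv (A i j) \<odot> A i k = \<bottom>z"
  by (simp add: matrix_iff)

lemma matrix_col: "A \<in> carrier (matrices S) \<Longrightarrow> i \<noteq> j \<Longrightarrow> A i k \<odot> sinv (A j k) = \<bottom>z"
  by (simp add: matrix_iff)

lemma matrix_support: "A \<in> carrier (matrices S) \<Longrightarrow> finite {(i, j). A i j \<noteq> \<bottom>z}"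
  by (simp add: matrix_iff)

lemma matrix_szero: "\<bottom>z\<^bsub>matrices S\<^esub> = (\<lambda>i j. \<bottom>z)"
  by (simp only: matrices_def semigroup_zero.simps)

lemma matrix_smult:
  "A \<cdot> B = (\<lambda>i j. \<Squnion>\<^bsub>natural_order S\<^esub> (range (\<lambda>k. A i k \<odot> B k j)))"
  by (simp only: matrices_def semigroup_zero.simps)

lemma sinv_eq_zero: "s \<in> carrier S \<Longrightarrow> sinv s = \<bottom>z \<longleftrightarrow> s = \<bottom>z"
  using sinv_sinv[of s] sinv_zero by metis

lemma adjoint_closed [simp]:
  assumes A: "A \<in> carrier (matrices S)"
  shows "adjoint A \<in> carrier (matrices S)"
proof -
  have "{(i, j). adjoint A i j \<noteq> \<bottom>z} = prod.swap ` {(i, j). A i j \<noteq> \<bottom>z}"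
    using A by (auto simp: sinv_eq_zero)
  then show ?thesis
    using A matrix_support[OF A] by (auto simp: matrix_iff)
qed

lemma adjoint_adjoint [simp]: "A \<in> carrier (matrices S) \<Longrightarrow> adjoint (adjoint A) = A"
  by (auto simp: adjoint_def)

text \<open>The matrix conditions say exactly what is needed for the join that defines an entry of the product:
for \<open>k \<noteq> l\<close> the row condition of \<open>A\<close> gives \<open>(a\<^sub>i\<^sub>k b\<^sub>k\<^sub>j)\<^sup>-\<^sup>1 (a\<^sub>i\<^sub>l b\<^sub>l\<^sub>j) = 0\<close>, and the column condition of \<open>B\<close>
gives the other half of orthogonality.\<close>

lemma product_terms:
  assumes A: "A \<in> carrier (matrices S)" and B: "B \<in> carrier (matrices S)"
  shows "finite (range (\<lambda>k. A i k \<odot> B k j))" "range (\<lambda>k. A i k \<odot> B k j) \<subseteq> carrier S"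
    "pairwise (orthogonal S) (range (\<lambda>k. A i k \<odot> B k j))"
proof -
  have "{k. A i k \<noteq> \<bottom>z} \<subseteq> snd ` {(i, j). A i j \<noteq> \<bottom>z}" by force
  then have "finite {k. A i k \<noteq> \<bottom>z}" using matrix_support[OF A] finite_surj by blast
  moreover have "range (\<lambda>k. A i k \<odot> B k j) \<subseteq>
      insert \<bottom>z ((\<lambda>k. A i k \<odot> B k j) ` {k. A i k \<noteq> \<bottom>z})"
  proof (rule image_subsetI)
    fix k show "A i k \<odot> B k j \<in> insert \<bottom>z ((\<lambda>k. A i k \<odot> B k j) ` {k. A i k \<noteq> \<bottom>z})"
      using B by (cases "A i k = \<bottom>z") auto
  qed
  ultimately show "finite (range (\<lambda>k. A i k \<odot> B k j))" using finite_subset by blast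
  show "range (\<lambda>k. A i k \<odot> B k j) \<subseteq> carrier S" using A B by auto
  show "pairwise (orthogonal S) (range (\<lambda>k. A i k \<odot> B k j))"
    unfolding pairwise_def
  proof clarsimp
    fix k l assume "A i k \<odot> B k j \<noteq> A i l \<odot> B l j"
    then have kl: "k \<noteq> l" by auto
    have "sinv (A i k \<odot> B k j) \<odot> (A i l \<odot> B l j) =
        sinv (B k j) \<odot> (sinv (A i k) \<odot> A i l) \<odot> B l j"
      using A B by (simp add: sinv_mult smult_assoc)
    moreover have "A i k \<odot> B k j \<odot> sinv (A i l \<odot> B l j) =
        A i k \<odot> (B k j \<odot> sinv (B l j)) \<odot> sinv (A i l)"
      using A B by (simp add: sinv_mult smult_assoc)
    ultimately show "orthogonal S (A i k \<odot> B k j) (A i l \<odot> B l j)"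
      using A B by (simp add: orthogonal_def matrix_row matrix_col kl)
  qed
qed

lemma mult_lub:
  assumes "A \<in> carrier (matrices S)" "B \<in> carrier (matrices S)"
  shows "lub S ((A \<cdot> B) i j) (range (\<lambda>k. A i k \<odot> B k j))"
  unfolding matrix_smult by (rule lub_Join) (rule product_terms[OF assms])+

lemma mult_entry [simp]:
  "\<lbrakk>A \<in> carrier (matrices S); B \<in> carrier (matrices S)\<rbrakk> \<Longrightarrow> (A \<cdot> B) i j \<in> carrier S"
  using mult_lub lub_closed by blast

text \<open>The terms of the two entries are \<open>a\<^sub>i\<^sub>l b\<^sub>l\<^sub>j\<close> and \<open>a\<^sub>i\<^sub>m b\<^sub>m\<^sub>k\<close>. They are killed by the row condition of \<open>A\<close> if
\<open>l \<noteq> m\<close>; otherwise only the idempotent \<open>a\<^sub>i\<^sub>l\<^sup>-\<^sup>1 a\<^sub>i\<^sub>l\<close> separates \<open>b\<^sub>l\<^sub>j\<^sup>-\<^sup>1\<close> from \<open>b\<^sub>l\<^sub>k\<close>, and the row condition of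
\<open>B\<close> applies.\<close>

lemma mult_row:
  assumes A: "A \<in> carrier (matrices S)" and B: "B \<in> carrier (matrices S)" and "j \<noteq> k"
  shows "sinv ((A \<cdot> B) i j) \<odot> (A \<cdot> B) i k = \<bottom>z"
proof (rule lub_mult_lub_zero)
  show "lub S ((A \<cdot> B) i j) (range (\<lambda>k. A i k \<odot> B k j))"
    "lub S ((A \<cdot> B) i k) (range (\<lambda>l. A i l \<odot> B l k))"
    using A B by (rule mult_lub)+
  fix a b assume "a \<in> range (\<lambda>k. A i k \<odot> B k j)" "b \<in> range (\<lambda>l. A i l \<odot> B l k)"
  then obtain l m where a: "a = A i l \<odot> B l j" and b: "b = A i m \<odot> B m k" by auto
  have ab: "sinv a \<odot> b = sinv (B l j) \<odot> ((sinv (A i l) \<odot> A i m) \<odot> B m k)"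
    using A B by (simp add: a b sinv_mult smult_assoc)
  show "sinv a \<odot> b = \<bottom>z"
  proof (cases "l = m")
    case True
    have "sinv (B l j) \<odot> ((sinv (A i l) \<odot> A i l) \<odot> B l k) = \<bottom>z"
      by (rule mult_zero_insert_idempotent) (use A B matrix_row[OF B \<open>j \<noteq> k\<close>] in auto)
    with ab True show ?thesis by simp
  next
    case False
    then show ?thesis using ab A B by (simp add: matrix_row)
  qed
qed (use A B product_terms in auto)

lemma adjoint_mult:
  assumes A: "A \<in> carrier (matrices S)" and B: "B \<in> carrier (matrices S)"
  shows "adjoint (A \<cdot> B) = adjoint B \<cdot> adjoint A"
proof (intro ext)
  fix i j
  have "lub S (adjoint (A \<cdot> B) i j) ((\<lambda>a. sinv a) ` range (\<lambda>k. A j k \<odot> B k i))"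
    using lub_sinv[OF mult_lub[OF A B] product_terms(2)[OF A B]] by simp
  also have "(\<lambda>a. sinv a) ` range (\<lambda>k. A j k \<odot> B k i) =
      range (\<lambda>k. adjoint B i k \<odot> adjoint A k j)"
    using A B by (simp add: image_image sinv_mult)
  finally show "adjoint (A \<cdot> B) i j = (adjoint B \<cdot> adjoint A) i j"
    by (rule lub_unique) (use A B in \<open>simp add: mult_lub del: adjoint_apply\<close>)
qed

lemma mult_closed [simp]:
  assumes A: "A \<in> carrier (matrices S)" and B: "B \<in> carrier (matrices S)"
  shows "A \<cdot> B \<in> carrier (matrices S)"
  unfolding matrix_iff
proof (intro conjI allI impI)
  fix i j k :: nat
  show "(A \<cdot> B) i j \<in> carrier S" using A B by simp
  show "sinv ((A \<cdot> B) i j) \<odot> (A \<cdot> B) i k = \<bottom>z" if "j \<noteq> k"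
    using A B that by (rule mult_row)
  show "(A \<cdot> B) i k \<odot> sinv ((A \<cdot> B) j k) = \<bottom>z" if "i \<noteq> j"
  proof -
    \<comment> \<open>The column condition of a matrix is the row condition of its adjoint.\<close>
    have "sinv (adjoint (A \<cdot> B) k i) \<odot> adjoint (A \<cdot> B) k j = \<bottom>z"
      unfolding adjoint_mult[OF A B] by (rule mult_row) (use A B that in auto)
    then show ?thesis using A B by simp
  qed
next
  have "{(i, j). (A \<cdot> B) i j \<noteq> \<bottom>z} \<subseteq>
      fst ` {(i, j). A i j \<noteq> \<bottom>z} \<times> snd ` {(i, j). B i j \<noteq> \<bottom>z}"
  proof (rule subrelI)
    fix i j assume "(i, j) \<in> {(i, j). (A \<cdot> B) i j \<noteq> \<bottom>z}"
    then have "(A \<cdot> B) i j \<noteq> \<bottom>z" by simp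
    then have "\<not> range (\<lambda>k. A i k \<odot> B k j) \<subseteq> {\<bottom>z}" using mult_lub[OF A B] lub_zero by blast
    then obtain k where "A i k \<odot> B k j \<noteq> \<bottom>z" by auto
    then have "A i k \<noteq> \<bottom>z" "B k j \<noteq> \<bottom>z" using A B by auto
    then show "(i, j) \<in> fst ` {(i, j). A i j \<noteq> \<bottom>z} \<times> snd ` {(i, j). B i j \<noteq> \<bottom>z}"
      by (intro SigmaI image_eqI[of _ fst "(i, k)"] image_eqI[of _ snd "(k, j)"]) simp_all
  qed
  then show "finite {(i, j). (A \<cdot> B) i j \<noteq> \<bottom>z}"
    by (rule finite_subset) (use matrix_support[OF A] matrix_support[OF B] in auto)
qed

text \<open>Both bracketings of a triple product are joins of the same set of triple products of entries; this is
associativity, and it also gives a formula for the entries of \<open>A (A\<^sup>* A)\<close> and \<open>B (A\<^sup>* A)\<close>.\<close>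

lemma mult3_lub:
  assumes A: "A \<in> carrier (matrices S)" and B: "B \<in> carrier (matrices S)"
    and C: "C \<in> carrier (matrices S)"
  shows "lub S ((A \<cdot> (B \<cdot> C)) i j) (\<Union>k. range (\<lambda>l. A i k \<odot> (B k l \<odot> C l j)))"
    "lub S ((A \<cdot> B \<cdot> C) i j) (\<Union>k. range (\<lambda>l. A i k \<odot> (B k l \<odot> C l j)))"
proof -
  have "lub S ((A \<cdot> (B \<cdot> C)) i j) (range (\<lambda>k. A i k \<odot> (B \<cdot> C) k j))"
    using A B C by (simp add: mult_lub)
  then show "lub S ((A \<cdot> (B \<cdot> C)) i j) (\<Union>k. range (\<lambda>l. A i k \<odot> (B k l \<odot> C l j)))"
  proof (subst (asm) lub_UN)
    fix k
    show "lub S (A i k \<odot> (B \<cdot> C) k j) (range (\<lambda>l. A i k \<odot> (B k l \<odot> C l j)))"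
      using smult_distrib_left[OF product_terms[OF B C] mult_lub[OF B C], of "A i k"] A
      by (simp add: image_image)
  qed (use A B C in auto)
  have "lub S ((A \<cdot> B \<cdot> C) i j) (range (\<lambda>l. (A \<cdot> B) i l \<odot> C l j))"
    using A B C by (simp add: mult_lub)
  then have "lub S ((A \<cdot> B \<cdot> C) i j) (\<Union>l. range (\<lambda>k. A i k \<odot> B k l \<odot> C l j))"
  proof (subst (asm) lub_UN)
    fix l
    show "lub S ((A \<cdot> B) i l \<odot> C l j) (range (\<lambda>k. A i k \<odot> B k l \<odot> C l j))"
      using smult_distrib_right[OF product_terms[OF A B] mult_lub[OF A B], of "C l j"] C
      by (simp add: image_image)
  qed (use A B C in auto)
  moreover have "(\<Union>l. range (\<lambda>k. A i k \<odot> B k l \<odot> C l j)) =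
      (\<Union>k. range (\<lambda>l. A i k \<odot> (B k l \<odot> C l j)))"
    using A B C by (auto simp: smult_assoc)
  ultimately show "lub S ((A \<cdot> B \<cdot> C) i j) (\<Union>k. range (\<lambda>l. A i k \<odot> (B k l \<odot> C l j)))"
    by simp
qed

lemma mult_assoc:
  assumes "A \<in> carrier (matrices S)" "B \<in> carrier (matrices S)" "C \<in> carrier (matrices S)"
  shows "A \<cdot> B \<cdot> C = A \<cdot> (B \<cdot> C)"
  by (intro ext lub_unique[OF mult3_lub(2,1)[OF assms]])

text \<open>In the join for the entry at \<open>(i, j)\<close> the term \<open>a\<^sub>i\<^sub>k a\<^sub>l\<^sub>k\<^sup>-\<^sup>1 a\<^sub>l\<^sub>j\<close> vanishes by the column condition unless
\<open>l = i\<close>, and then by the row condition unless \<open>k = j\<close>.\<close>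

lemma mult_adjoint_mult:
  assumes A: "A \<in> carrier (matrices S)"
  shows "A \<cdot> (adjoint A \<cdot> A) = A"
proof (intro ext)
  fix i j
  let ?X = "\<Union>k. range (\<lambda>l. A i k \<odot> (adjoint A k l \<odot> A l j))"
  have z: "A i k \<odot> (sinv (A l k) \<odot> A l j) = \<bottom>z" if "i \<noteq> l \<or> k \<noteq> j" for k l
  proof (cases "i = l")
    case True
    then show ?thesis using A that by (simp add: matrix_row)
  next
    case False
    have "A i k \<odot> (sinv (A l k) \<odot> A l j) = A i k \<odot> sinv (A l k) \<odot> A l j"
      using A by (simp add: smult_assoc)
    then show ?thesis using A False by (simp add: matrix_col)
  qed
  have "lub S (A i j) ?X"
  proof (rule lub_max)
    have "A i j \<odot> (adjoint A j i \<odot> A i j) = A i j" using A by simp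
    then have "A i j \<in> range (\<lambda>l. A i j \<odot> (adjoint A j l \<odot> A l j))"
      by (intro range_eqI[of _ _ i]) (rule sym)
    then show "A i j \<in> ?X" by blast
    show "?X \<subseteq> carrier S" using A by auto
    fix b assume "b \<in> ?X"
    then obtain k l where b: "b = A i k \<odot> (sinv (A l k) \<odot> A l j)" by auto
    show "b \<preceq> A i j" using z[of l k] A by (cases "i = l \<and> k = j") (auto simp: b)
  qed
  with mult3_lub(1)[OF A _ A] show "(A \<cdot> (adjoint A \<cdot> A)) i j = A i j"
    using A lub_unique adjoint_closed by blast
qed

definition diagonal :: "(nat \<Rightarrow> nat \<Rightarrow> 'a) \<Rightarrow> bool" where
  "diagonal A \<longleftrightarrow> (\<forall>i j. i \<noteq> j \<longrightarrow> A i j = \<bottom>z)"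

lemma lub_single_term:
  assumes "\<And>k. f k \<in> carrier S" "\<And>k. k \<noteq> i \<Longrightarrow> f k = \<bottom>z"
  shows "lub S (f i) (range f)"
  by (rule lub_max) (use assms in \<open>auto, metis natural.le_refl carrier_natural_order zero_nle\<close>)

lemma diagonal_mult:
  assumes "diagonal P" and P: "P \<in> carrier (matrices S)" and A: "A \<in> carrier (matrices S)"
  shows "(P \<cdot> A) i j = P i i \<odot> A i j"
  by (rule lub_unique[OF mult_lub[OF P A] lub_single_term])
    (use assms in \<open>auto simp: diagonal_def\<close>)

lemma mult_diagonal:
  assumes "diagonal P" and P: "P \<in> carrier (matrices S)" and A: "A \<in> carrier (matrices S)"
  shows "(A \<cdot> P) i j = A i j \<odot> P j j"
  by (rule lub_unique[OF mult_lub[OF A P] lub_single_term])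
    (use assms in \<open>auto simp: diagonal_def\<close>)

lemma diagonal_adjoint_mult:
  assumes A: "A \<in> carrier (matrices S)"
  shows "diagonal (adjoint A \<cdot> A)"
  unfolding diagonal_def
proof (intro allI impI)
  fix i j :: nat assume "i \<noteq> j"
  then show "(adjoint A \<cdot> A) i j = \<bottom>z"
    by (intro lub_zero[OF mult_lub[OF adjoint_closed[OF A] A]]) (use A in \<open>auto simp: matrix_row\<close>)
qed

text \<open>The adjoint of an idempotent is idempotent, hence \<open>E = E E\<^sup>* E = (E E\<^sup>*) (E\<^sup>* E)\<close>, a product of two
diagonal matrices.\<close>

lemma idempotent_matrix_diagonal:
  assumes E: "E \<in> idempotents (matrices S)"
  shows "diagonal E"
proof -
  have c [simp]: "E \<in> carrier (matrices S)" and EE: "E \<cdot> E = E"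
    using E by (auto simp: idempotents_def)
  have d: "diagonal (E \<cdot> adjoint E)" using diagonal_adjoint_mult[of "adjoint E"] by simp
  have "E = E \<cdot> (adjoint (E \<cdot> E) \<cdot> E)" by (simp add: EE mult_adjoint_mult)
  also have "\<dots> = (E \<cdot> adjoint E) \<cdot> (adjoint E \<cdot> E)"
    by (simp add: adjoint_mult mult_assoc del: adjoint_apply)
  finally have "E i j = (E \<cdot> adjoint E) i i \<odot> (adjoint E \<cdot> E) i j" for i j
    using diagonal_mult[OF d, of "adjoint E \<cdot> E"] by (metis adjoint_closed c mult_closed)
  moreover have "(adjoint E \<cdot> E) i j = \<bottom>z" if "i \<noteq> j" for i j
    using diagonal_adjoint_mult[OF c] that unfolding diagonal_def by blast
  moreover have "(E \<cdot> adjoint E) i i \<odot> \<bottom>z = \<bottom>z" for i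
    by (rule szero_right) (rule mult_entry, simp_all)
  ultimately show ?thesis
    unfolding diagonal_def by metis
qed

lemma idempotent_matrix_entry:
  assumes E: "E \<in> idempotents (matrices S)"
  shows "E i i \<in> idempotents S"
proof -
  have c: "E \<in> carrier (matrices S)" and EE: "E \<cdot> E = E"
    using E by (auto simp: idempotents_def)
  have "E i i \<odot> E i i = E i i"
    using diagonal_mult[OF idempotent_matrix_diagonal[OF E] c c, of i i] by (simp add: EE)
  then show ?thesis using c by (simp add: idempotentI)
qed

lemma idempotent_matrices_commute:
  assumes E: "E \<in> idempotents (matrices S)" and F: "F \<in> idempotents (matrices S)"
  shows "E \<cdot> F = F \<cdot> E"
proof (intro ext)
  fix i j
  have c [simp]: "E \<in> carrier (matrices S)" "F \<in> carrier (matrices S)"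
    using E F by (auto simp: idempotents_def)
  have "(E \<cdot> F) i j = E i i \<odot> F i j" "(F \<cdot> E) i j = F i i \<odot> E i j"
    using E F by (auto intro!: diagonal_mult idempotent_matrix_diagonal)
  moreover have "E i j = \<bottom>z" "F i j = \<bottom>z" if "i \<noteq> j"
    using idempotent_matrix_diagonal[OF E] idempotent_matrix_diagonal[OF F] that
    by (auto simp: diagonal_def)
  moreover have "E i i \<odot> F i i = F i i \<odot> E i i"
    using E F by (intro idempotents_commute idempotent_matrix_entry)
  ultimately show "(E \<cdot> F) i j = (F \<cdot> E) i j" by (cases "i = j") auto
qed

text \<open>The adjoint is an inverse by \<open>mult_adjoint_mult\<close>. Uniqueness is the usual argument for regular
semigroups with commuting idempotents: another inverse \<open>B\<close> satisfies
\<open>B = B A A\<^sup>* A B = A\<^sup>* A B = A\<^sup>* (A A\<^sup>*) (A B) = A\<^sup>* (A B) (A A\<^sup>*) = A\<^sup>*\<close>.\<close>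

lemma inverse_semigroup_matrices: "inverse_semigroup_zero (matrices S)"
proof
  fix A assume A [simp]: "A \<in> carrier (matrices S)"
  have 1: "A \<cdot> (adjoint A \<cdot> A) = A" "adjoint A \<cdot> (A \<cdot> adjoint A) = adjoint A"
    using mult_adjoint_mult[of A] mult_adjoint_mult[of "adjoint A"] by auto
  have uniq: "B = adjoint A" if B [simp]: "B \<in> carrier (matrices S)"
    and ABA: "A \<cdot> (B \<cdot> A) = A" and BAB: "B \<cdot> (A \<cdot> B) = B" for B
  proof -
    have idem: "A \<cdot> B \<in> idempotents (matrices S)" "B \<cdot> A \<in> idempotents (matrices S)"
      "A \<cdot> adjoint A \<in> idempotents (matrices S)" "adjoint A \<cdot> A \<in> idempotents (matrices S)"
      by (simp_all add: idempotents_def mult_assoc ABA BAB 1)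
    have cancel: "A \<cdot> (adjoint A \<cdot> (A \<cdot> C)) = A \<cdot> C" "A \<cdot> (B \<cdot> (A \<cdot> C)) = A \<cdot> C"
      if "C \<in> carrier (matrices S)" for C
      using that arg_cong[OF 1(1), of "\<lambda>X. X \<cdot> C"] arg_cong[OF ABA, of "\<lambda>X. X \<cdot> C"]
      by (simp_all add: mult_assoc)
    have "B = B \<cdot> A \<cdot> (adjoint A \<cdot> A) \<cdot> B"
      by (simp add: mult_assoc ABA BAB 1)
    also have "\<dots> = adjoint A \<cdot> A \<cdot> (B \<cdot> A) \<cdot> B"
      using idempotent_matrices_commute[OF idem(2,4)] by simp
    also have "\<dots> = adjoint A \<cdot> (A \<cdot> B)" by (simp add: mult_assoc BAB)
    also have "\<dots> = adjoint A \<cdot> ((A \<cdot> adjoint A) \<cdot> (A \<cdot> B))"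
      by (simp add: mult_assoc cancel)
    also have "\<dots> = adjoint A \<cdot> ((A \<cdot> B) \<cdot> (A \<cdot> adjoint A))"
      using idempotent_matrices_commute[OF idem(1,3)] by simp
    also have "\<dots> = adjoint A"
      by (simp add: mult_assoc cancel 1)
    finally show ?thesis .
  qed
  show "\<exists>!B. B \<in> carrier (matrices S) \<and> A \<cdot> B \<cdot> A = A \<and> B \<cdot> A \<cdot> B = B"
    by (rule ex1I[of _ "adjoint A"]) (auto simp: mult_assoc 1 intro: uniq)
next
  show z: "\<bottom>z\<^bsub>matrices S\<^esub> \<in> carrier (matrices S)" by (simp add: matrix_iff matrix_szero)
  fix A assume A: "A \<in> carrier (matrices S)"
  have d: "diagonal \<bottom>z\<^bsub>matrices S\<^esub>" by (simp add: diagonal_def matrix_szero)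
  show "\<bottom>z\<^bsub>matrices S\<^esub> \<cdot> A = \<bottom>z\<^bsub>matrices S\<^esub>"
    using diagonal_mult[OF d z A] A by (auto simp: matrix_szero)
  show "A \<cdot> \<bottom>z\<^bsub>matrices S\<^esub> = \<bottom>z\<^bsub>matrices S\<^esub>"
    using mult_diagonal[OF d z A] A by (auto simp: matrix_szero)
qed (simp_all add: mult_assoc)

interpretation M: inverse_semigroup_zero "matrices S"
  by (rule inverse_semigroup_matrices)

lemma sinv_matrix: "A \<in> carrier (matrices S) \<Longrightarrow> sinv\<^bsub>matrices S\<^esub> A = adjoint A"
  using mult_adjoint_mult[of A] mult_adjoint_mult[of "adjoint A"]
  by (intro M.sinv_eqI) auto

text \<open>If \<open>A \<le> B\<close>, then \<open>A = E B\<close> with \<open>E\<close> diagonal, so entries can be compared. Conversely \<open>A = B A\<^sup>* A\<close> has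
to be shown: the entry at \<open>(i, j)\<close> is a join of terms \<open>b\<^sub>i\<^sub>k a\<^sub>l\<^sub>k\<^sup>-\<^sup>1 a\<^sub>l\<^sub>j\<close>, which vanish for \<open>k \<noteq> j\<close> by the row
condition of \<open>A\<close> and for \<open>l \<noteq> i\<close> by the column condition of \<open>B\<close>, because \<open>a\<^sub>l\<^sub>k\<close> is below \<open>b\<^sub>l\<^sub>k\<close>.\<close>

lemma nle_matrix_iff:
  assumes A: "A \<in> carrier (matrices S)" and B: "B \<in> carrier (matrices S)"
  shows "A \<sqsubseteq>\<^bsub>natural_order (matrices S)\<^esub> B \<longleftrightarrow> (\<forall>i j. A i j \<preceq> B i j)"
proof
  assume "A \<sqsubseteq>\<^bsub>natural_order (matrices S)\<^esub> B"
  then obtain E where E: "E \<in> idempotents (matrices S)" and "A = E \<cdot> B"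
    using A B M.nle_leftE by blast
  then have "A i j = E i i \<odot> B i j" for i j
    using B by (simp add: diagonal_mult idempotent_matrix_diagonal M.idempotentD)
  then show "\<forall>i j. A i j \<preceq> B i j"
    using B idempotent_matrix_entry[OF E] by (auto intro: idempotent_mult_nle)
next
  assume le: "\<forall>i j. A i j \<preceq> B i j"
  have "B \<cdot> (adjoint A \<cdot> A) = A"
  proof (intro ext)
    fix i j
    let ?X = "\<Union>k. range (\<lambda>l. B i k \<odot> (adjoint A k l \<odot> A l j))"
    have Bij: "B i j \<odot> (sinv (A i j) \<odot> A i j) = A i j"
      using le A B unfolding nle_def by (metis matrix_entry sinv_closed smult_assoc)
    have z: "B i k \<odot> (sinv (A l k) \<odot> A l j) = \<bottom>z" if "i \<noteq> l \<or> k \<noteq> j" for k l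
    proof (cases "k = j")
      case False
      then show ?thesis using A B by (simp add: matrix_row)
    next
      case True
      then have "i \<noteq> l" using that by simp
      obtain e where e: "e \<in> idempotents S" "A l k = e \<odot> B l k"
        using le A B by (metis nle_leftE matrix_entry)
      have "B i k \<odot> (sinv (A l k) \<odot> A l j) = B i k \<odot> sinv (B l k) \<odot> (e \<odot> A l j)"
        using A B e idempotentD[OF e(1)] by (simp add: sinv_mult smult_assoc)
      then show ?thesis using A B e(1) \<open>i \<noteq> l\<close> by (simp add: matrix_col idempotentD)
    qed
    have "lub S (A i j) ?X"
    proof (rule lub_max)
      have "B i j \<odot> (adjoint A j i \<odot> A i j) = A i j" using Bij by simp
      then have "A i j \<in> range (\<lambda>l. B i j \<odot> (adjoint A j l \<odot> A l j))"
      by (intro range_eqI[of _ _ i]) (rule sym)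
    then show "A i j \<in> ?X" by blast
      show "?X \<subseteq> carrier S" using A B by auto
      fix b assume "b \<in> ?X"
      then obtain k l where b: "b = B i k \<odot> (sinv (A l k) \<odot> A l j)" by auto
      show "b \<preceq> A i j" using z[of l k] A Bij by (cases "i = l \<and> k = j") (auto simp: b)
    qed
    with mult3_lub(1)[OF B _ A] show "(B \<cdot> (adjoint A \<cdot> A)) i j = A i j"
      using A lub_unique adjoint_closed by blast
  qed
  then show "A \<sqsubseteq>\<^bsub>natural_order (matrices S)\<^esub> B"
    using A B by (simp add: M.nle_def sinv_matrix mult_assoc)
qed

lemma lub_matrixI:
  assumes X: "X \<in> carrier (matrices S)" and sub: "\<A> \<subseteq> carrier (matrices S)"
    and l: "\<And>i j. lub S (X i j) ((\<lambda>A. A i j) ` \<A>)"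
  shows "lub (matrices S) X \<A>"
proof (rule M.lubI)
  fix A assume "A \<in> \<A>"
  then show "A \<sqsubseteq>\<^bsub>natural_order (matrices S)\<^esub> X"
    using sub X by (subst nle_matrix_iff) (auto intro!: lub_upper[OF l])
next
  fix U assume U: "U \<in> carrier (matrices S)" "\<And>A. A \<in> \<A> \<Longrightarrow> A \<sqsubseteq>\<^bsub>natural_order (matrices S)\<^esub> U"
  then have "A i j \<preceq> U i j" if "A \<in> \<A>" for A i j
    using nle_matrix_iff[of A U] sub that by auto
  then show "X \<sqsubseteq>\<^bsub>natural_order (matrices S)\<^esub> U"
    using X U(1) by (subst nle_matrix_iff) (auto intro!: lub_least[OF l])
qed fact+

lemma orthogonal_matrices_iff:
  assumes A: "A \<in> carrier (matrices S)" and B: "B \<in> carrier (matrices S)"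
  shows "orthogonal (matrices S) A B \<longleftrightarrow>
    (\<forall>i j k. sinv (A k i) \<odot> B k j = \<bottom>z) \<and> (\<forall>i j k. A i k \<odot> sinv (B j k) = \<bottom>z)"
proof -
  have *: "A \<cdot> B = \<bottom>z\<^bsub>matrices S\<^esub> \<longleftrightarrow> (\<forall>i j k. A i k \<odot> B k j = \<bottom>z)"
    if A: "A \<in> carrier (matrices S)" and B: "B \<in> carrier (matrices S)" for A B
  proof
    assume "A \<cdot> B = \<bottom>z\<^bsub>matrices S\<^esub>"
    then have "(A \<cdot> B) i j = \<bottom>z" for i j by (simp add: matrix_szero)
    moreover have "A i k \<odot> B k j \<preceq> (A \<cdot> B) i j" for i j k
      by (rule lub_upper[OF mult_lub[OF A B] rangeI product_terms(2)[OF A B]])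
    ultimately have "A i k \<odot> B k j \<preceq> \<bottom>z" for i j k by metis
    then show "\<forall>i j k. A i k \<odot> B k j = \<bottom>z" using A B by (simp add: nle_def)
  next
    assume "\<forall>i j k. A i k \<odot> B k j = \<bottom>z"
    then show "A \<cdot> B = \<bottom>z\<^bsub>matrices S\<^esub>"
      by (intro ext) (auto simp: matrix_szero intro!: lub_zero[OF mult_lub[OF A B]])
  qed
  show ?thesis using A B by (auto simp: orthogonal_def sinv_matrix *)
qed

lemma orthogonal_matricesD:
  assumes "orthogonal (matrices S) A B" "A \<in> carrier (matrices S)" "B \<in> carrier (matrices S)"
  shows "sinv (A k i) \<odot> B k j = \<bottom>z" "A i k \<odot> sinv (B j k) = \<bottom>z"
  using assms by (simp_all add: orthogonal_matrices_iff)

lemma lub_mult_sinv_lub_zero: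
  assumes A: "finite A" "A \<subseteq> carrier S" "pairwise (orthogonal S) A" "lub S x A"
    and B: "finite B" "B \<subseteq> carrier S" "pairwise (orthogonal S) B" "lub S y B"
    and z: "\<And>a b. \<lbrakk>a \<in> A; b \<in> B\<rbrakk> \<Longrightarrow> a \<odot> sinv b = \<bottom>z"
  shows "x \<odot> sinv y = \<bottom>z"
proof -
  have "sinv (sinv x) \<odot> sinv y = \<bottom>z"
  proof (rule lub_mult_lub_zero)
    show "lub S (sinv x) ((\<lambda>a. sinv a) ` A)" using A by (simp add: lub_sinv)
    show "lub S (sinv y) ((\<lambda>a. sinv a) ` B)" using B by (simp add: lub_sinv)
  qed (use A B z in \<open>auto simp: pairwise_orthogonal_sinv subset_iff\<close>)
  then show ?thesis using lub_closed[OF A(4)] by simp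
qed

lemma orthogonal_matrices_entries:
  assumes "finite \<A>" and sub: "\<A> \<subseteq> carrier (matrices S)"
    and o: "pairwise (orthogonal (matrices S)) \<A>"
  shows "finite ((\<lambda>A. A i j) ` \<A>)" "(\<lambda>A. A i j) ` \<A> \<subseteq> carrier S"
    "pairwise (orthogonal S) ((\<lambda>A. A i j) ` \<A>)"
proof -
  show "finite ((\<lambda>A. A i j) ` \<A>)" using assms by simp
  show "(\<lambda>A. A i j) ` \<A> \<subseteq> carrier S" using sub by auto
  show "pairwise (orthogonal S) ((\<lambda>A. A i j) ` \<A>)"
    unfolding pairwise_def
  proof clarsimp
    fix A B assume "A \<in> \<A>" "B \<in> \<A>" "A i j \<noteq> B i j"
    then have "orthogonal (matrices S) A B" using o unfolding pairwise_def by metis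
    then show "orthogonal S (A i j) (B i j)"
      using orthogonal_matricesD[of A B] subsetD[OF sub \<open>A \<in> \<A>\<close>] subsetD[OF sub \<open>B \<in> \<A>\<close>]
      by (simp add: orthogonal_def[of S])
  qed
qed

text \<open>The entrywise join is again a matrix: for two members \<open>A\<close>, \<open>B\<close> of the family the products that have to vanish
do so by orthogonality if \<open>A \<noteq> B\<close>, and by the matrix conditions of \<open>A\<close> if \<open>A = B\<close>.\<close>

lemma orthogonal_matrices_lub:
  assumes fin: "finite \<A>" and sub: "\<A> \<subseteq> carrier (matrices S)"
    and o: "pairwise (orthogonal (matrices S)) \<A>"
  obtains X where "lub (matrices S) X \<A>" "\<And>i j. lub S (X i j) ((\<lambda>A. A i j) ` \<A>)"
proof -
  note entries = orthogonal_matrices_entries[OF assms]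
  define X where "X = (\<lambda>i j. \<Squnion>\<^bsub>natural_order S\<^esub> ((\<lambda>A. A i j) ` \<A>))"
  have l: "lub S (X i j) ((\<lambda>A. A i j) ` \<A>)" for i j
    unfolding X_def by (rule lub_Join) (rule entries)+
  have "X \<in> carrier (matrices S)"
    unfolding matrix_iff
  proof (intro conjI allI impI)
    fix i j k :: nat
    show "X i j \<in> carrier S" using l lub_closed by blast
    show "sinv (X i j) \<odot> X i k = \<bottom>z" if "j \<noteq> k"
    proof (rule lub_mult_lub_zero[OF entries l entries l])
      fix a b assume "a \<in> (\<lambda>A. A i j) ` \<A>" "b \<in> (\<lambda>A. A i k) ` \<A>"
      then obtain A B where AB: "A \<in> \<A>" "B \<in> \<A>" "a = A i j" "b = B i k" by auto
      show "sinv a \<odot> b = \<bottom>z"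
      proof (cases "A = B")
        case True
        then show ?thesis using AB subsetD[OF sub] matrix_row[of A j k i] that by simp
      next
        case False
        then have "orthogonal (matrices S) A B" using o AB unfolding pairwise_def by metis
        then show ?thesis using orthogonal_matricesD[of A B] AB subsetD[OF sub] by simp
      qed
    qed
    show "X i k \<odot> sinv (X j k) = \<bottom>z" if "i \<noteq> j"
    proof (rule lub_mult_sinv_lub_zero[OF entries l entries l])
      fix a b assume "a \<in> (\<lambda>A. A i k) ` \<A>" "b \<in> (\<lambda>A. A j k) ` \<A>"
      then obtain A B where AB: "A \<in> \<A>" "B \<in> \<A>" "a = A i k" "b = B j k" by auto
      show "a \<odot> sinv b = \<bottom>z"
      proof (cases "A = B")
        case True
        then show ?thesis using AB subsetD[OF sub] matrix_col[of A i j k] that by simp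
      next
        case False
        then have "orthogonal (matrices S) A B" using o AB unfolding pairwise_def by metis
        then show ?thesis using orthogonal_matricesD[of A B] AB subsetD[OF sub] by simp
      qed
    qed
  next
    have "{(i, j). X i j \<noteq> \<bottom>z} \<subseteq> (\<Union>A\<in>\<A>. {(i, j). A i j \<noteq> \<bottom>z})"
      using lub_zero[OF l] by blast
    then show "finite {(i, j). X i j \<noteq> \<bottom>z}"
      by (rule finite_subset) (use fin sub matrix_support in auto)
  qed
  then have "lub (matrices S) X \<A>" using sub l by (rule lub_matrixI)
  with l that show ?thesis by blast
qed

lemma orthogonal_lub_entries:
  assumes "finite \<A>" "\<A> \<subseteq> carrier (matrices S)" "pairwise (orthogonal (matrices S)) \<A>"
    and X: "lub (matrices S) X \<A>"
  shows "lub S (X i j) ((\<lambda>A. A i j) ` \<A>)"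
  using orthogonal_matrices_lub[OF assms(1-3)] M.lub_unique[OF X] by metis

text \<open>Joins being entrywise, distributivity is an interchange of the join over the family with the join that
defines the matrix product.\<close>

theorem orthogonally_complete_matrices: "orthogonally_complete_inverse_semigroup (matrices S)"
proof
  fix A B assume AB: "A \<in> carrier (matrices S)" "B \<in> carrier (matrices S)"
    "orthogonal (matrices S) A B"
  then have "pairwise (orthogonal (matrices S)) {A, B}"
    using M.orthogonal_sym by (auto simp: pairwise_insert)
  then obtain X where "lub (matrices S) X {A, B}"
    by (rule orthogonal_matrices_lub[rotated 2]) (use AB in auto)
  then show "\<exists>X. lub (matrices S) X {A, B}" by blast
next
  fix \<A> X U
  assume \<A>: "finite \<A>" "\<A> \<subseteq> carrier (matrices S)" "pairwise (orthogonal (matrices S)) \<A>"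
    and X: "lub (matrices S) X \<A>" and U: "U \<in> carrier (matrices S)"
  note entries = orthogonal_matrices_entries[OF \<A>]
  note l = orthogonal_lub_entries[OF \<A> X]
  have Xc [simp]: "X \<in> carrier (matrices S)" using X M.lub_closed by blast
  have \<A>c: "A \<in> carrier (matrices S)" if "A \<in> \<A>" for A using \<A> that by auto
  show "lub (matrices S) (U \<cdot> X) ((\<lambda>A. U \<cdot> A) ` \<A>)"
  proof (rule lub_matrixI)
    fix i j
    have "lub S ((U \<cdot> X) i j) (range (\<lambda>k. U i k \<odot> X k j))"
      using U Xc by (rule mult_lub)
    then have "lub S ((U \<cdot> X) i j) (\<Union>k. (\<lambda>A. U i k \<odot> A k j) ` \<A>)"
    proof (subst (asm) lub_UN)
      fix k
      show "lub S (U i k \<odot> X k j) ((\<lambda>A. U i k \<odot> A k j) ` \<A>)"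
        using smult_distrib_left[OF entries l, of "U i k"] U by (simp add: image_image)
    qed (use U \<A>c in auto)
    also have "(\<Union>k. (\<lambda>A. U i k \<odot> A k j) ` \<A>) = (\<Union>A\<in>\<A>. range (\<lambda>k. U i k \<odot> A k j))" by auto
    finally have "lub S ((U \<cdot> X) i j) ((\<lambda>A. (U \<cdot> A) i j) ` \<A>)"
      by (subst lub_UN) (use U \<A>c mult_lub in auto)
    then show "lub S ((U \<cdot> X) i j) ((\<lambda>A. A i j) ` (\<lambda>A. U \<cdot> A) ` \<A>)" by (simp add: image_image)
  qed (use U \<A>c in auto)
  show "lub (matrices S) (X \<cdot> U) ((\<lambda>A. A \<cdot> U) ` \<A>)"
  proof (rule lub_matrixI)
    fix i j
    have "lub S ((X \<cdot> U) i j) (range (\<lambda>k. X i k \<odot> U k j))"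
      using Xc U by (rule mult_lub)
    then have "lub S ((X \<cdot> U) i j) (\<Union>k. (\<lambda>A. A i k \<odot> U k j) ` \<A>)"
    proof (subst (asm) lub_UN)
      fix k
      show "lub S (X i k \<odot> U k j) ((\<lambda>A. A i k \<odot> U k j) ` \<A>)"
        using smult_distrib_right[OF entries l, of "U k j"] U by (simp add: image_image)
    qed (use U \<A>c in auto)
    also have "(\<Union>k. (\<lambda>A. A i k \<odot> U k j) ` \<A>) = (\<Union>A\<in>\<A>. range (\<lambda>k. A i k \<odot> U k j))" by auto
    finally have "lub S ((X \<cdot> U) i j) ((\<lambda>A. (A \<cdot> U) i j) ` \<A>)"
      by (subst lub_UN) (use U \<A>c mult_lub in auto)
    then show "lub S ((X \<cdot> U) i j) ((\<lambda>A. A i j) ` (\<lambda>A. A \<cdot> U) ` \<A>)" by (simp add: image_image)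
  qed (use U \<A>c in auto)
qed

lemma diagonal_idempotent_matrix:
  assumes e: "\<And>i. e i \<in> idempotents S" and fin: "finite {i. e i \<noteq> \<bottom>z}"
  shows "(\<lambda>i j. if i = j then e i else \<bottom>z) \<in> idempotents (matrices S)" (is "?E \<in> _")
proof -
  have "{(i, j). ?E i j \<noteq> \<bottom>z} \<subseteq> (\<lambda>i. (i, i)) ` {i. e i \<noteq> \<bottom>z}" by auto
  then have "finite {(i, j). ?E i j \<noteq> \<bottom>z}" using fin finite_surj by blast
  then have c: "?E \<in> carrier (matrices S)" using idempotentD(1)[OF e] by (auto simp: matrix_iff)
  moreover have "?E \<cdot> ?E = ?E"
    using diagonal_mult[OF _ c c] idempotentD(1,2)[OF e]
    by (intro ext) (auto simp: diagonal_def)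
  ultimately show ?thesis by (simp add: idempotents_def)
qed

text \<open>The copy is \<open>A A\<^sup>*\<close> for the matrix \<open>A\<close> that carries the diagonal of \<open>E\<close> in its \<open>n\<close>-th subdiagonal: it is \<open>E\<close>
shifted by \<open>n\<close>, and for large \<open>n\<close> it avoids the support of \<open>F\<close>.\<close>

lemma orthogonal_copy_exists:
  assumes E: "E \<in> idempotents (matrices S)" and F: "F \<in> idempotents (matrices S)"
  shows "\<exists>E'. (E, E') \<in> D_rel (matrices S) \<and> orthogonal (matrices S) E' F"
proof -
  note [simp] = M.idempotentD(1)[OF E] M.idempotentD(1)[OF F]
  have "finite (fst ` {(i, j). F i j \<noteq> \<bottom>z})" using matrix_support[of F] by simp
  then obtain n where "\<forall>i \<in> fst ` {(i, j). F i j \<noteq> \<bottom>z}. i < n"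
    unfolding finite_nat_set_iff_bounded by blast
  then have n: "F i j = \<bottom>z" if "\<not> i < n" for i j
    using that image_eqI[of i fst "(i, j)" "{(i, j). F i j \<noteq> \<bottom>z}"] by auto
  define A where "A = (\<lambda>i j. if i = j + n then E j j else \<bottom>z)"
  have "{(i, j). A i j \<noteq> \<bottom>z} \<subseteq> (\<lambda>(i, j). (i + n, j)) ` {(i, j). E i j \<noteq> \<bottom>z}"
  proof (rule subrelI)
    fix i j assume "(i, j) \<in> {(i, j). A i j \<noteq> \<bottom>z}"
    then have "i = j + n" "E j j \<noteq> \<bottom>z" by (simp_all add: A_def split: if_splits)
    then show "(i, j) \<in> (\<lambda>(i, j). (i + n, j)) ` {(i, j). E i j \<noteq> \<bottom>z}"
      by (intro image_eqI[of _ _ "(j, j)"]) simp_all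
  qed
  then have "finite {(i, j). A i j \<noteq> \<bottom>z}" 
    by (rule finite_subset) (simp add: matrix_support)
  then have A [simp]: "A \<in> carrier (matrices S)"
    unfolding matrix_iff by (auto simp: A_def)
  have "adjoint A \<cdot> A = E"
  proof (intro ext)
    fix i j
    show "(adjoint A \<cdot> A) i j = E i j"
    proof (cases "i = j")
      case True
      have "lub S (adjoint A i (i + n) \<odot> A (i + n) i) (range (\<lambda>k. adjoint A i k \<odot> A k i))"
        by (rule lub_single_term) (auto simp: A_def)
      moreover have "adjoint A i (i + n) \<odot> A (i + n) i = E i i"
        using idempotent_matrix_entry[OF E, of i] by (simp add: A_def idempotentD)
      ultimately have "lub S (E i i) (range (\<lambda>k. adjoint A i k \<odot> A k i))" by simp
      then show ?thesis
        unfolding True[symmetric] by (rule lub_unique[OF mult_lub[OF adjoint_closed[OF A] A]])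
    next
      case False
      then show ?thesis
        using diagonal_adjoint_mult[OF A] idempotent_matrix_diagonal[OF E] by (simp add: diagonal_def)
    qed
  qed
  then have "(E, A \<cdot> adjoint A) \<in> D_rel (matrices S)"
    using E M.range_idempotent[of A] by (auto simp: D_rel_def sinv_matrix)
  moreover have "orthogonal (matrices S) (A \<cdot> adjoint A) F"
  proof -
    have idem: "A \<cdot> adjoint A \<in> idempotents (matrices S)"
      using M.range_idempotent[of A] by (simp add: sinv_matrix)
    have "(A \<cdot> adjoint A) i i \<odot> F i j = \<bottom>z" for i j
    proof (cases "i < n")
      case True
      then have "(A \<cdot> adjoint A) i i = \<bottom>z"
        by (intro lub_zero[OF mult_lub[OF A adjoint_closed[OF A]]]) (auto simp: A_def)
      then show ?thesis by simp
    next
      case False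
      then have "F i j = \<bottom>z" by (rule n)
      then show ?thesis by simp
    qed
    then have "A \<cdot> adjoint A \<cdot> F = \<bottom>z\<^bsub>matrices S\<^esub>"
      using diagonal_mult[OF idempotent_matrix_diagonal[OF idem], of F]
      by (intro ext) (simp add: matrix_szero)
    then show ?thesis using M.orthogonal_idempotents[OF idem F] by simp
  qed
  ultimately show ?thesis by blast
qed

end

section \<open>The commutative monoid of classes of idempotents\<close>

context inverse_semigroup_zero
begin

lemma D_relI:
  "\<lbrakk>s \<in> carrier S; e = sinv s \<odot> s; f = s \<odot> sinv s\<rbrakk> \<Longrightarrow> (e, f) \<in> D_rel S"
  by (auto simp: D_rel_def)

lemma D_relE:
  assumes "(e, f) \<in> D_rel S"
  obtains s where "s \<in> carrier S" "e = sinv s \<odot> s" "f = s \<odot> sinv s"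
  using assms by (auto simp: D_rel_def)

lemma D_rel_idempotents: "(e, f) \<in> D_rel S \<Longrightarrow> e \<in> idempotents S \<and> f \<in> idempotents S"
  by (auto simp: D_rel_def)

lemma equiv_D_rel: "equiv (idempotents S) (D_rel S)"
proof (rule equivI)
  show "D_rel S \<subseteq> idempotents S \<times> idempotents S" using D_rel_idempotents by auto
  show "refl_on (idempotents S) (D_rel S)"
  proof (rule refl_onI)
    fix e assume "e \<in> idempotents S"
    then show "(e, e) \<in> D_rel S" by (intro D_relI[of e]) (simp_all add: idempotentD)
  qed
  show "sym (D_rel S)"
  proof (rule symI)
    fix e f assume "(e, f) \<in> D_rel S"
    then obtain s where "s \<in> carrier S" "e = sinv s \<odot> s" "f = s \<odot> sinv s" by (rule D_relE)
    then show "(f, e) \<in> D_rel S" by (intro D_relI[of "sinv s"]) simp_all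
  qed
  show "trans (D_rel S)"
  proof (rule transI)
    fix e f g assume "(e, f) \<in> D_rel S" "(f, g) \<in> D_rel S"
    then obtain s t where [simp]: "s \<in> carrier S" "t \<in> carrier S"
      and e: "e = sinv s \<odot> s" and f: "f = s \<odot> sinv s" "f = sinv t \<odot> t" and g: "g = t \<odot> sinv t"
      by (elim D_relE)
    show "(e, g) \<in> D_rel S"
    proof (rule D_relI[of "t \<odot> s"])
      have "sinv (t \<odot> s) \<odot> (t \<odot> s) = sinv s \<odot> (sinv t \<odot> t) \<odot> s"
        by (simp add: sinv_mult smult_assoc)
      also have "\<dots> = e" unfolding f(2)[symmetric] f(1) by (simp add: smult_assoc e)
      finally show "e = sinv (t \<odot> s) \<odot> (t \<odot> s)" by simp
      have "t \<odot> s \<odot> sinv (t \<odot> s) = t \<odot> (s \<odot> sinv s) \<odot> sinv t"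
        by (simp add: sinv_mult smult_assoc)
      also have "\<dots> = g" unfolding f(1)[symmetric] f(2) by (simp add: smult_assoc g)
      finally show "g = t \<odot> s \<odot> sinv (t \<odot> s)" by simp
    qed simp
  qed
qed

lemma orthogonal_idempotent_below:
  assumes "orthogonal S g x" "e \<preceq> x"
    and g: "g \<in> idempotents S" and x: "x \<in> idempotents S" and e: "e \<in> idempotents S"
  shows "orthogonal S g e"
proof -
  note [simp] = idempotentD[OF g] idempotentD[OF x] idempotentD[OF e]
  have "e = x \<odot> e" using \<open>e \<preceq> x\<close> by (simp add: nle_def e smult_assoc)
  then have "g \<odot> e = g \<odot> x \<odot> e" by (simp add: smult_assoc)
  also have "\<dots> = \<bottom>z" using assms(1) g x by (simp add: orthogonal_idempotents)
  finally show ?thesis using g e by (simp add: orthogonal_idempotents)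
qed

end

context orthogonally_complete_inverse_semigroup
begin

abbreviation ojoin (infixl "\<squnion>o" 65) where "s \<squnion>o t \<equiv> s \<squnion>\<^bsub>natural_order S\<^esub> t"

lemma lub_join:
  assumes "s \<in> carrier S" "t \<in> carrier S" "orthogonal S s t"
  shows "lub S (s \<squnion>o t) {s, t}"
  using orthogonal_join_exists[OF assms] join_eq by auto

lemma join_closed:
  "\<lbrakk>s \<in> carrier S; t \<in> carrier S; orthogonal S s t\<rbrakk> \<Longrightarrow> s \<squnion>o t \<in> carrier S"
  using lub_join lub_closed by blast

text \<open>The mixed terms \<open>s\<^sup>-\<^sup>1 t\<close> and \<open>t\<^sup>-\<^sup>1 s\<close> of \<open>(s \<squnion> t)\<^sup>-\<^sup>1 (s \<squnion> t)\<close> vanish.\<close>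

lemma domain_join:
  assumes [simp]: "s \<in> carrier S" "t \<in> carrier S" and o: "orthogonal S s t"
  shows "sinv (s \<squnion>o t) \<odot> (s \<squnion>o t) = (sinv s \<odot> s) \<squnion>o (sinv t \<odot> t)"
proof -
  define x where "x = s \<squnion>o t"
  have x: "lub S x {s, t}" unfolding x_def by (rule lub_join) (simp_all add: o)
  then have [simp]: "x \<in> carrier S" by (rule lub_closed)
  have o': "orthogonal S t s" using o by (simp add: orthogonal_sym)
  have pw: "pairwise (orthogonal S) {s, t}" using o o' by (auto simp: pairwise_insert)
  have *: "sinv x \<odot> a = sinv a \<odot> a" if a: "a \<in> {s, t}" for a
  proof -
    have [simp]: "a \<in> carrier S" using a by auto
    have "lub S (sinv x \<odot> a) ((\<lambda>b. b \<odot> a) ` (\<lambda>b. sinv b) ` {s, t})"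
      by (rule smult_distrib_right[OF _ _ _ lub_sinv[OF x]])
        (use pairwise_orthogonal_sinv[OF _ pw] in simp_all)
    moreover have "lub S (sinv a \<odot> a) ((\<lambda>b. b \<odot> a) ` (\<lambda>b. sinv b) ` {s, t})"
      by (rule lub_max) (use a o o' in \<open>auto simp: orthogonal_def\<close>)
    ultimately show ?thesis by (rule lub_unique)
  qed
  have "lub S (sinv x \<odot> x) ((\<lambda>a. sinv x \<odot> a) ` {s, t})"
    by (rule smult_distrib_left[OF _ _ pw x]) simp_all
  then have "lub S (sinv x \<odot> x) {sinv s \<odot> s, sinv t \<odot> t}" using *[of s] *[of t] by simp
  then show ?thesis unfolding x_def[symmetric] by (simp only: join_eq)
qed

lemma sinv_join:
  assumes "s \<in> carrier S" "t \<in> carrier S" "orthogonal S s t"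
  shows "sinv (s \<squnion>o t) = sinv s \<squnion>o sinv t"
  using lub_sinv[OF lub_join[OF assms]] assms by (simp add: join_eq)

lemma range_join:
  assumes [simp]: "s \<in> carrier S" "t \<in> carrier S" and o: "orthogonal S s t"
  shows "(s \<squnion>o t) \<odot> sinv (s \<squnion>o t) = (s \<odot> sinv s) \<squnion>o (t \<odot> sinv t)"
proof -
  have "orthogonal S (sinv s) (sinv t)" using o by (auto simp: orthogonal_def)
  from domain_join[OF _ _ this] show ?thesis
    by (simp add: sinv_join[OF _ _ o, symmetric] join_closed[OF _ _ o])
qed

lemma join_idempotent:
  assumes e: "e \<in> idempotents S" and f: "f \<in> idempotents S" and o: "orthogonal S e f"
  shows "e \<squnion>o f \<in> idempotents S"
proof -
  note [simp] = idempotentD[OF e] idempotentD[OF f]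
  have "sinv (e \<squnion>o f) \<odot> (e \<squnion>o f) = e \<squnion>o f" using domain_join[OF _ _ o] e f by simp
  then show ?thesis using domain_idempotent[OF join_closed[OF _ _ o]] by simp
qed

text \<open>The join of the two witnesses is a witness. It exists because \<open>s\<^sup>-\<^sup>1 t = s\<^sup>-\<^sup>1 e' f' t\<close> and
\<open>s t\<^sup>-\<^sup>1 = s e f t\<^sup>-\<^sup>1\<close> vanish.\<close>

lemma D_rel_join:
  assumes "(e, e') \<in> D_rel S" "(f, f') \<in> D_rel S" "orthogonal S e f" "orthogonal S e' f'"
  shows "(e \<squnion>o f, e' \<squnion>o f') \<in> D_rel S"
proof -
  obtain s where s [simp]: "s \<in> carrier S" and e: "e = sinv s \<odot> s" "e' = s \<odot> sinv s"
    using assms(1) by (rule D_relE)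
  obtain t where t [simp]: "t \<in> carrier S" and f: "f = sinv t \<odot> t" "f' = t \<odot> sinv t"
    using assms(2) by (rule D_relE)
  have ef: "sinv s \<odot> s \<odot> (sinv t \<odot> t) = \<bottom>z" "s \<odot> sinv s \<odot> (t \<odot> sinv t) = \<bottom>z"
    using assms(3,4) by (simp_all add: e f orthogonal_idempotents)
  have "sinv s \<odot> t = sinv s \<odot> (s \<odot> sinv s \<odot> (t \<odot> sinv t)) \<odot> t" by (simp add: smult_assoc)
  moreover have "s \<odot> sinv t = s \<odot> (sinv s \<odot> s \<odot> (sinv t \<odot> t)) \<odot> sinv t"
    by (simp add: smult_assoc)
  ultimately have o: "orthogonal S s t" by (simp add: orthogonal_def ef)
  show ?thesis
    by (rule D_relI[of "s \<squnion>o t"]) (simp_all add: e f domain_join range_join o join_closed)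
qed

abbreviation idempotent_class where "idempotent_class e \<equiv> D_rel S `` {e}"

text \<open>All choices of orthogonal representatives yield the same class, so the union that defines the sum has
just one value.\<close>

lemma idempotent_class_mult:
  assumes e: "e \<in> idempotents S" and f: "f \<in> idempotents S" and o: "orthogonal S e f"
  shows "idempotent_class e \<otimes>\<^bsub>idempotent_classes S\<^esub> idempotent_class f = idempotent_class (e \<squnion>o f)"
proof -
  have "idempotent_class (e' \<squnion>o f') = idempotent_class (e \<squnion>o f)"
    if "e' \<in> idempotent_class e" "f' \<in> {f' \<in> idempotent_class f. orthogonal S e' f'}" for e' f'
    using that o by (intro equiv_class_eq[OF equiv_D_rel, symmetric] D_rel_join) auto
  moreover have "e \<in> idempotent_class e" "f \<in> {f' \<in> idempotent_class f. orthogonal S e f'}"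
    using equiv_class_self[OF equiv_D_rel] e f o by auto
  ultimately have "(\<Union>e'\<in>idempotent_class e. \<Union>f'\<in>{f' \<in> idempotent_class f. orthogonal S e' f'}.
      idempotent_class (e' \<squnion>o f')) = idempotent_class (e \<squnion>o f)"
    by fast
  then show ?thesis by (simp add: idempotent_classes_def)
qed

lemma idempotent_class_closed:
  "e \<in> idempotents S \<Longrightarrow> idempotent_class e \<in> carrier (idempotent_classes S)"
  by (simp add: idempotent_classes_def quotientI)

lemma idempotent_classE:
  assumes "X \<in> carrier (idempotent_classes S)"
  obtains e where "e \<in> idempotents S" "X = idempotent_class e"
  using assms by (auto simp: idempotent_classes_def elim: quotientE)

lemma idempotent_class_one: "\<one>\<^bsub>idempotent_classes S\<^esub> = idempotent_class \<bottom>z"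
  by (simp add: idempotent_classes_def)

end

text \<open>The property of matrix semigroups that makes the sum of any two classes meaningful; without it, the
union that defines the sum may be empty.\<close>

locale semigroup_with_orthogonal_copies = orthogonally_complete_inverse_semigroup +
  assumes orthogonal_copy:
    "\<lbrakk>e \<in> idempotents S; f \<in> idempotents S\<rbrakk> \<Longrightarrow> \<exists>e'. (e, e') \<in> D_rel S \<and> orthogonal S e' f"
begin

lemma orthogonal_representative:
  assumes "X \<in> carrier (idempotent_classes S)" and f: "f \<in> idempotents S"
  obtains e where "e \<in> idempotents S" "X = idempotent_class e" "orthogonal S f e"
proof -
  obtain e where "e \<in> idempotents S" and X: "X = idempotent_class e"
    using assms(1) by (rule idempotent_classE)
  then obtain e' where e': "(e, e') \<in> D_rel S" "orthogonal S e' f"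
    using orthogonal_copy f by blast
  then have "e' \<in> idempotents S" using D_rel_idempotents by blast
  moreover have "X = idempotent_class e'"
    unfolding X by (rule equiv_class_eq[OF equiv_D_rel e'(1)])
  moreover have "orthogonal S f e'"
    using e'(2) orthogonal_sym idempotentD(1) \<open>e' \<in> idempotents S\<close> f by blast
  ultimately show ?thesis using that by blast
qed

text \<open>Given three classes, representatives can be chosen one after the other so that they are pairwise
orthogonal: the third is chosen orthogonal to the join of the first two, hence to each of them. Both
bracketings are then the class of the join of the three.\<close>

theorem comm_monoid_idempotent_classes: "comm_monoid (idempotent_classes S)"
proof (rule comm_monoidI)
  fix X Y assume X: "X \<in> carrier (idempotent_classes S)" and Y: "Y \<in> carrier (idempotent_classes S)"
  obtain e where e: "e \<in> idempotents S" "X = idempotent_class e" using X by (rule idempotent_classE)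
  obtain f where f: "f \<in> idempotents S" "Y = idempotent_class f" "orthogonal S e f"
    using Y e(1) by (rule orthogonal_representative)
  note [simp] = idempotentD(1)[OF e(1)] idempotentD(1)[OF f(1)]
  have ef: "e \<squnion>o f \<in> idempotents S" using join_idempotent e(1) f(1,3) .
  note [simp] = idempotentD(1)[OF ef]
  have XY: "X \<otimes>\<^bsub>idempotent_classes S\<^esub> Y = idempotent_class (e \<squnion>o f)"
    using e f by (simp add: idempotent_class_mult)
  show "X \<otimes>\<^bsub>idempotent_classes S\<^esub> Y \<in> carrier (idempotent_classes S)"
    unfolding XY using ef by (rule idempotent_class_closed)
  show "X \<otimes>\<^bsub>idempotent_classes S\<^esub> Y = Y \<otimes>\<^bsub>idempotent_classes S\<^esub> X"
  proof -
    have "Y \<otimes>\<^bsub>idempotent_classes S\<^esub> X = idempotent_class (f \<squnion>o e)"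
      unfolding e(2) f(2) by (rule idempotent_class_mult) (use e f orthogonal_sym in simp_all)
    then show ?thesis unfolding XY by (simp add: join_def insert_commute)
  qed
  fix Z assume Z: "Z \<in> carrier (idempotent_classes S)"
  obtain g where g: "g \<in> idempotents S" "Z = idempotent_class g" "orthogonal S (e \<squnion>o f) g"
    using Z ef by (rule orthogonal_representative)
  note [simp] = idempotentD(1)[OF g(1)]
  have g': "orthogonal S g (e \<squnion>o f)" using g(3) by (simp add: orthogonal_sym)
  have le: "e \<preceq> e \<squnion>o f" "f \<preceq> e \<squnion>o f" by (rule lub_upper[OF lub_join[OF _ _ f(3)]]; simp)+
  have ge: "orthogonal S e g" and gf: "orthogonal S f g"
    using orthogonal_idempotent_below[OF g' le(1) g(1) ef e(1)]
      orthogonal_idempotent_below[OF g' le(2) g(1) ef f(1)] by (simp_all add: orthogonal_sym)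
  have fg: "f \<squnion>o g \<in> idempotents S" using join_idempotent f(1) g(1) gf .
  note [simp] = idempotentD(1)[OF fg]
  have pw: "pairwise (orthogonal S) {f, g}" using gf orthogonal_sym by (auto simp: pairwise_insert)
  have e_fg: "orthogonal S e (f \<squnion>o g)"
    by (rule orthogonal_lub[OF _ _ pw lub_join[OF _ _ gf]]) (use f(3) ge in auto)
  have "lub S (e \<squnion>o f \<squnion>o g) {g, e \<squnion>o f}"
    using lub_join[OF _ _ g(3)] by (simp add: insert_commute)
  then have "lub S (e \<squnion>o f \<squnion>o g) {g, e, f}"
    by (subst (asm) lub_insert[OF lub_join[OF _ _ f(3)]]) simp_all
  moreover have "lub S (e \<squnion>o (f \<squnion>o g)) {e, f, g}"
    using lub_join[OF _ _ e_fg] lub_insert[OF lub_join[OF _ _ gf], of e] by simp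
  ultimately have assoc: "e \<squnion>o f \<squnion>o g = e \<squnion>o (f \<squnion>o g)"
    using lub_unique by (simp add: insert_commute)
  have "X \<otimes>\<^bsub>idempotent_classes S\<^esub> Y \<otimes>\<^bsub>idempotent_classes S\<^esub> Z = idempotent_class (e \<squnion>o f \<squnion>o g)"
    unfolding XY g(2) using ef g(1,3) by (rule idempotent_class_mult)
  also have "\<dots> = X \<otimes>\<^bsub>idempotent_classes S\<^esub> (Y \<otimes>\<^bsub>idempotent_classes S\<^esub> Z)"
    unfolding assoc e(2) f(2) g(2) using e(1) f(1) g(1) fg gf e_fg
    by (simp add: idempotent_class_mult)
  finally show "X \<otimes>\<^bsub>idempotent_classes S\<^esub> Y \<otimes>\<^bsub>idempotent_classes S\<^esub> Z =
      X \<otimes>\<^bsub>idempotent_classes S\<^esub> (Y \<otimes>\<^bsub>idempotent_classes S\<^esub> Z)" .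
next
  show "\<one>\<^bsub>idempotent_classes S\<^esub> \<in> carrier (idempotent_classes S)"
    by (simp add: idempotent_class_one idempotent_class_closed)
next
  fix X assume "X \<in> carrier (idempotent_classes S)"
  then obtain e where e: "e \<in> idempotents S" and X: "X = idempotent_class e"
    by (rule idempotent_classE)
  note [simp] = idempotentD(1)[OF e]
  have "lub S e {\<bottom>z, e}" by (rule lub_max) auto
  then have "\<bottom>z \<squnion>o e = e" by (rule join_eq)
  then show "\<one>\<^bsub>idempotent_classes S\<^esub> \<otimes>\<^bsub>idempotent_classes S\<^esub> X = X"
    using e by (simp add: X idempotent_class_one idempotent_class_mult)
qed

end

section \<open>Functoriality of the classes of idempotents\<close>

locale semigroup_zero_hom = S?: inverse_semigroup_zero S + T?: inverse_semigroup_zero T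
  for S (structure) and T (structure) +
  fixes \<phi>
  assumes szhom: "\<phi> \<in> szhom S T"
begin

lemma hom_closed [simp]: "s \<in> carrier S \<Longrightarrow> \<phi> s \<in> carrier T"
  using szhom by (auto simp: szhom_def)

lemma hom_mult [simp]:
  "\<lbrakk>s \<in> carrier S; t \<in> carrier S\<rbrakk> \<Longrightarrow> \<phi> (s \<odot>\<^bsub>S\<^esub> t) = \<phi> s \<odot>\<^bsub>T\<^esub> \<phi> t"
  using szhom by (auto simp: szhom_def)

lemma hom_zero [simp]: "\<phi> \<bottom>z\<^bsub>S\<^esub> = \<bottom>z\<^bsub>T\<^esub>"
  using szhom by (auto simp: szhom_def)

lemma hom_sinv [simp]:
  assumes [simp]: "s \<in> carrier S"
  shows "\<phi> (sinv\<^bsub>S\<^esub> s) = sinv\<^bsub>T\<^esub> (\<phi> s)"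
proof (rule T.sinv_eqI[symmetric])
  have "\<phi> (s \<odot>\<^bsub>S\<^esub> (sinv\<^bsub>S\<^esub> s \<odot>\<^bsub>S\<^esub> s)) = \<phi> s" by (subst S.sinv_cancel) simp_all
  then show "\<phi> s \<odot>\<^bsub>T\<^esub> (\<phi> (sinv\<^bsub>S\<^esub> s) \<odot>\<^bsub>T\<^esub> \<phi> s) = \<phi> s" by (simp del: S.sinv_cancel)
  have "\<phi> (sinv\<^bsub>S\<^esub> s \<odot>\<^bsub>S\<^esub> (s \<odot>\<^bsub>S\<^esub> sinv\<^bsub>S\<^esub> s)) = \<phi> (sinv\<^bsub>S\<^esub> s)" by (subst S.sinv_cancel) simp_all
  then show "\<phi> (sinv\<^bsub>S\<^esub> s) \<odot>\<^bsub>T\<^esub> (\<phi> s \<odot>\<^bsub>T\<^esub> \<phi> (sinv\<^bsub>S\<^esub> s)) = \<phi> (sinv\<^bsub>S\<^esub> s)"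
    by (simp del: S.sinv_cancel)
qed simp_all

lemma hom_idempotent:
  assumes "e \<in> idempotents S"
  shows "\<phi> e \<in> idempotents T"
  using assms hom_mult[of e e] by (simp add: idempotents_def)

lemma hom_orthogonal:
  assumes "orthogonal S s t" and [simp]: "s \<in> carrier S" "t \<in> carrier S"
  shows "orthogonal T (\<phi> s) (\<phi> t)"
proof -
  have "\<phi> (sinv\<^bsub>S\<^esub> s \<odot>\<^bsub>S\<^esub> t) = \<bottom>z\<^bsub>T\<^esub>" "\<phi> (s \<odot>\<^bsub>S\<^esub> sinv\<^bsub>S\<^esub> t) = \<bottom>z\<^bsub>T\<^esub>"
    using assms(1) by (simp_all only: orthogonal_def hom_zero)
  then show ?thesis by (simp add: orthogonal_def)
qed

lemma hom_D_rel: "(e, f) \<in> D_rel S \<Longrightarrow> (\<phi> e, \<phi> f) \<in> D_rel T"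
  by (elim S.D_relE) (auto intro: T.D_relI[OF hom_closed])

end

text \<open>A class \<open>X\<close> is sent to the \<open>\<D>\<close>-saturation of \<open>\<phi> X\<close>, which is a single class since \<open>\<phi>\<close> preserves \<open>\<D>\<close>.\<close>

lemma idempotent_classes_functorial:
  assumes "semigroup_with_orthogonal_copies S" "semigroup_with_orthogonal_copies T" "\<phi> \<in> szhom S T" "orthogonal_join_preserving S T \<phi>"
  obtains f where "f \<in> hom (idempotent_classes S) (idempotent_classes T)"
    "\<And>e. e \<in> idempotents S \<Longrightarrow> f (D_rel S `` {e}) = D_rel T `` {\<phi> e}"
proof -
  interpret S: semigroup_with_orthogonal_copies S by fact
  interpret T: semigroup_with_orthogonal_copies T by fact
  interpret semigroup_zero_hom S T \<phi> by unfold_locales fact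
  define f where "f = (\<lambda>X. D_rel T `` (\<phi> ` X))"
  have f: "f (S.idempotent_class e) = T.idempotent_class (\<phi> e)" if e: "e \<in> idempotents S" for e
  proof -
    have "T.idempotent_class (\<phi> e') = T.idempotent_class (\<phi> e)" if "e' \<in> S.idempotent_class e" for e'
      using that by (intro equiv_class_eq[OF T.equiv_D_rel, symmetric] hom_D_rel) simp
    moreover have "e \<in> S.idempotent_class e" using equiv_class_self[OF S.equiv_D_rel e] .
    moreover have "f (S.idempotent_class e) = (\<Union>e'\<in>S.idempotent_class e. T.idempotent_class (\<phi> e'))"
      unfolding f_def by blast
    ultimately show ?thesis by fast
  qed
  have "f \<in> hom (idempotent_classes S) (idempotent_classes T)"
  proof (rule homI)
    fix X assume X: "X \<in> carrier (idempotent_classes S)"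
    then obtain e where e: "e \<in> idempotents S" "X = S.idempotent_class e"
      by (rule S.idempotent_classE)
    then show "f X \<in> carrier (idempotent_classes T)"
      by (simp add: f hom_idempotent T.idempotent_class_closed)
    fix Y assume "Y \<in> carrier (idempotent_classes S)"
    then obtain e' where e': "e' \<in> idempotents S" "Y = S.idempotent_class e'" "orthogonal S e e'"
      using e(1) by (rule S.orthogonal_representative)
    note c = S.idempotentD(1)[OF e(1)] S.idempotentD(1)[OF e'(1)]
    have "f (X \<otimes>\<^bsub>idempotent_classes S\<^esub> Y) = T.idempotent_class (\<phi> (S.ojoin e e'))"
      using e e' by (simp add: S.idempotent_class_mult f S.join_idempotent)
    also have "\<phi> (S.ojoin e e') = T.ojoin (\<phi> e) (\<phi> e')"
      using assms(4) c e'(3) unfolding orthogonal_join_preserving_def by blast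
    also have "T.idempotent_class (T.ojoin (\<phi> e) (\<phi> e')) = f X \<otimes>\<^bsub>idempotent_classes T\<^esub> f Y"
      using e e' c by (simp add: f T.idempotent_class_mult hom_idempotent hom_orthogonal)
    finally show "f (X \<otimes>\<^bsub>idempotent_classes S\<^esub> Y) = f X \<otimes>\<^bsub>idempotent_classes T\<^esub> f Y" .
  qed
  with f that show ?thesis by blast
qed

section \<open>The Grothendieck group of a commutative monoid\<close>

context comm_monoid
begin

abbreviation difference :: "'a \<Rightarrow> 'a \<Rightarrow> ('a \<times> 'a) set" where
  "difference a b \<equiv> grothendieck_rel G `` {(a, b)}"

lemma grothendieck_rel_iff:
  "((a, b), (c, d)) \<in> grothendieck_rel G \<longleftrightarrow> a \<in> carrier G \<and> b \<in> carrier G \<and> c \<in> carrier G \<and>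
     d \<in> carrier G \<and> (\<exists>k\<in>carrier G. a \<otimes> d \<otimes> k = c \<otimes> b \<otimes> k)"
  by (simp add: grothendieck_rel_def)

lemma equiv_grothendieck_rel: "equiv (carrier G \<times> carrier G) (grothendieck_rel G)"
proof (rule equivI)
  show "grothendieck_rel G \<subseteq> (carrier G \<times> carrier G) \<times> (carrier G \<times> carrier G)"
    by (auto simp: grothendieck_rel_iff)
  show "refl_on (carrier G \<times> carrier G) (grothendieck_rel G)"
    by (auto simp: refl_on_def grothendieck_rel_iff)
  show "sym (grothendieck_rel G)"
  proof (rule symI, clarify)
    fix a b c d assume "((a, b), (c, d)) \<in> grothendieck_rel G"
    then show "((c, d), (a, b)) \<in> grothendieck_rel G"
      unfolding grothendieck_rel_iff by (metis (no_types))
  qed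
  show "trans (grothendieck_rel G)"
  proof (rule transI, clarify)
    fix a b c d e f
    assume "((a, b), (c, d)) \<in> grothendieck_rel G" "((c, d), (e, f)) \<in> grothendieck_rel G"
    then obtain k l where [simp]: "a \<in> carrier G" "b \<in> carrier G" "c \<in> carrier G" "d \<in> carrier G"
        "e \<in> carrier G" "f \<in> carrier G" "k \<in> carrier G" "l \<in> carrier G"
      and k: "a \<otimes> d \<otimes> k = c \<otimes> b \<otimes> k" and l: "c \<otimes> f \<otimes> l = e \<otimes> d \<otimes> l"
      by (auto simp: grothendieck_rel_iff)
    have "a \<otimes> f \<otimes> (d \<otimes> k \<otimes> l) = (a \<otimes> d \<otimes> k) \<otimes> (f \<otimes> l)" by (simp add: m_ac)
    also have "\<dots> = (c \<otimes> f \<otimes> l) \<otimes> (b \<otimes> k)" unfolding k by (simp add: m_ac)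
    also have "\<dots> = e \<otimes> b \<otimes> (d \<otimes> k \<otimes> l)" unfolding l by (simp add: m_ac)
    finally show "((a, b), (e, f)) \<in> grothendieck_rel G"
      unfolding grothendieck_rel_iff by (intro conjI bexI[of _ "d \<otimes> k \<otimes> l"]) simp_all
  qed
qed

lemma difference_eqI: "((a, b), (c, d)) \<in> grothendieck_rel G \<Longrightarrow> difference a b = difference c d"
  by (rule equiv_class_eq[OF equiv_grothendieck_rel])

lemma difference_closed:
  "\<lbrakk>a \<in> carrier G; b \<in> carrier G\<rbrakk> \<Longrightarrow> difference a b \<in> carrier (grothendieck_group G)"
  by (auto simp: grothendieck_group_def intro: quotientI)

lemma differenceE:
  assumes "X \<in> carrier (grothendieck_group G)"
  obtains a b where "a \<in> carrier G" "b \<in> carrier G" "X = difference a b"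
  using assms by (auto simp: grothendieck_group_def elim!: quotientE)

lemma difference_mult:
  assumes [simp]: "a \<in> carrier G" "b \<in> carrier G" "c \<in> carrier G" "d \<in> carrier G"
  shows "difference a b \<otimes>\<^bsub>grothendieck_group G\<^esub> difference c d = difference (a \<otimes> c) (b \<otimes> d)"
proof -
  have eq: "difference (a' \<otimes> c') (b' \<otimes> d') = difference (a \<otimes> c) (b \<otimes> d)"
    if ab: "(a', b') \<in> difference a b" and cd: "(c', d') \<in> difference c d" for a' b' c' d'
  proof -
    obtain k l where [simp]: "a' \<in> carrier G" "b' \<in> carrier G" "c' \<in> carrier G" "d' \<in> carrier G"
        "k \<in> carrier G" "l \<in> carrier G"
      and k: "a \<otimes> b' \<otimes> k = a' \<otimes> b \<otimes> k" and l: "c \<otimes> d' \<otimes> l = c' \<otimes> d \<otimes> l"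
      using ab cd by (auto simp: grothendieck_rel_iff)
    have "(a \<otimes> c) \<otimes> (b' \<otimes> d') \<otimes> (k \<otimes> l) = (a \<otimes> b' \<otimes> k) \<otimes> (c \<otimes> d' \<otimes> l)" by (simp add: m_ac)
    also have "\<dots> = (a' \<otimes> c') \<otimes> (b \<otimes> d) \<otimes> (k \<otimes> l)" unfolding k l by (simp add: m_ac)
    finally have "((a \<otimes> c, b \<otimes> d), (a' \<otimes> c', b' \<otimes> d')) \<in> grothendieck_rel G"
      unfolding grothendieck_rel_iff by (intro conjI bexI[of _ "k \<otimes> l"]) simp_all
    then show ?thesis by (rule difference_eqI[symmetric])
  qed
  have "(a, b) \<in> difference a b" "(c, d) \<in> difference c d"
    using equiv_class_self[OF equiv_grothendieck_rel] by simp_all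
  then have "(\<Union>(a', b')\<in>difference a b. \<Union>(c', d')\<in>difference c d.
      difference (a' \<otimes> c') (b' \<otimes> d')) = difference (a \<otimes> c) (b \<otimes> d)"
    using eq by fast
  then show ?thesis by (simp add: grothendieck_group_def)
qed

lemma difference_one: "\<one>\<^bsub>grothendieck_group G\<^esub> = difference \<one> \<one>"
  by (simp add: grothendieck_group_def)

lemma group_grothendieck_group: "group (grothendieck_group G)"
proof (rule groupI)
  fix X Y assume "X \<in> carrier (grothendieck_group G)" "Y \<in> carrier (grothendieck_group G)"
  then show "X \<otimes>\<^bsub>grothendieck_group G\<^esub> Y \<in> carrier (grothendieck_group G)"
    by (elim differenceE) (simp add: difference_mult difference_closed)
  fix Z assume "Z \<in> carrier (grothendieck_group G)"
  with \<open>X \<in> _\<close> \<open>Y \<in> _\<close> show "X \<otimes>\<^bsub>grothendieck_group G\<^esub> Y \<otimes>\<^bsub>grothendieck_group G\<^esub> Z =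
      X \<otimes>\<^bsub>grothendieck_group G\<^esub> (Y \<otimes>\<^bsub>grothendieck_group G\<^esub> Z)"
    by (elim differenceE) (simp add: difference_mult m_assoc)
next
  show "\<one>\<^bsub>grothendieck_group G\<^esub> \<in> carrier (grothendieck_group G)"
    by (simp add: difference_one difference_closed)
next
  fix X assume "X \<in> carrier (grothendieck_group G)"
  then obtain a b where [simp]: "a \<in> carrier G" "b \<in> carrier G" and X: "X = difference a b"
    by (rule differenceE)
  show "\<one>\<^bsub>grothendieck_group G\<^esub> \<otimes>\<^bsub>grothendieck_group G\<^esub> X = X"
    by (simp add: X difference_one difference_mult)
  have "difference b a \<otimes>\<^bsub>grothendieck_group G\<^esub> X = \<one>\<^bsub>grothendieck_group G\<^esub>"
    by (simp add: X difference_one difference_mult)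
      (rule difference_eqI, auto simp: grothendieck_rel_iff m_comm)
  then show "\<exists>Y\<in>carrier (grothendieck_group G).
      Y \<otimes>\<^bsub>grothendieck_group G\<^esub> X = \<one>\<^bsub>grothendieck_group G\<^esub>"
    using difference_closed[of b a] by auto
qed

end

text \<open>A formal difference \<open>(a, b)\<close> is sent to \<open>(f a, f b)\<close>; as for \<open>idempotent_classes_functorial\<close> the map is
given on whole classes by saturating the image, to avoid a choice of representatives.\<close>

lemma grothendieck_group_functorial:
  assumes "comm_monoid G" "comm_monoid H" and hom: "f \<in> hom G H"
  obtains h where "group_hom (grothendieck_group G) (grothendieck_group H) h"
    "\<And>a b. \<lbrakk>a \<in> carrier G; b \<in> carrier G\<rbrakk> \<Longrightarrow>
       h (grothendieck_rel G `` {(a, b)}) = grothendieck_rel H `` {(f a, f b)}"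
    "f ` carrier G = carrier H \<Longrightarrow>
       h ` carrier (grothendieck_group G) = carrier (grothendieck_group H)"
proof -
  interpret G: comm_monoid G by fact
  interpret H: comm_monoid H by fact
  have fc [simp]: "f a \<in> carrier H" if "a \<in> carrier G" for a
    using hom_in_carrier[OF hom that] .
  define h where "h = (\<lambda>X. grothendieck_rel H `` (map_prod f f ` X))"
  have h: "h (G.difference a b) = H.difference (f a) (f b)"
    if [simp]: "a \<in> carrier G" "b \<in> carrier G" for a b
  proof -
    have "H.difference (f c) (f d) = H.difference (f a) (f b)" if "(c, d) \<in> G.difference a b" for c d
    proof -
      obtain k where [simp]: "c \<in> carrier G" "d \<in> carrier G" "k \<in> carrier G"
        and "a \<otimes>\<^bsub>G\<^esub> d \<otimes>\<^bsub>G\<^esub> k = c \<otimes>\<^bsub>G\<^esub> b \<otimes>\<^bsub>G\<^esub> k"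
        using \<open>(c, d) \<in> _\<close> by (auto simp: G.grothendieck_rel_iff)
      then have "f (a \<otimes>\<^bsub>G\<^esub> d \<otimes>\<^bsub>G\<^esub> k) = f (c \<otimes>\<^bsub>G\<^esub> b \<otimes>\<^bsub>G\<^esub> k)" by simp
      then have "f a \<otimes>\<^bsub>H\<^esub> f d \<otimes>\<^bsub>H\<^esub> f k = f c \<otimes>\<^bsub>H\<^esub> f b \<otimes>\<^bsub>H\<^esub> f k"
        by (simp add: hom_mult[OF hom])
      then have "((f a, f b), (f c, f d)) \<in> grothendieck_rel H"
        unfolding H.grothendieck_rel_iff by (intro conjI bexI[of _ "f k"]) simp_all
      then show ?thesis by (rule H.difference_eqI[symmetric])
    qed
    moreover have "(a, b) \<in> G.difference a b"
      using equiv_class_self[OF G.equiv_grothendieck_rel] by simp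
    moreover have "h (G.difference a b) =
        (\<Union>(c, d)\<in>G.difference a b. H.difference (f c) (f d))"
      unfolding h_def by force
    ultimately show ?thesis by fast
  qed
  have "h \<in> hom (grothendieck_group G) (grothendieck_group H)"
  proof (rule homI)
    fix X assume "X \<in> carrier (grothendieck_group G)"
    then show "h X \<in> carrier (grothendieck_group H)"
      by (elim G.differenceE) (simp add: h H.difference_closed)
    fix Y assume "Y \<in> carrier (grothendieck_group G)"
    with \<open>X \<in> _\<close> show "h (X \<otimes>\<^bsub>grothendieck_group G\<^esub> Y) = h X \<otimes>\<^bsub>grothendieck_group H\<^esub> h Y"
      by (elim G.differenceE) (simp add: h G.difference_mult H.difference_mult hom_mult[OF hom])
  qed
  then have "group_hom (grothendieck_group G) (grothendieck_group H) h"
    by (intro group_hom.intro group_hom_axioms.intro G.group_grothendieck_group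
        H.group_grothendieck_group)
  moreover have "h ` carrier (grothendieck_group G) = carrier (grothendieck_group H)"
    if surj: "f ` carrier G = carrier H"
  proof
    show "h ` carrier (grothendieck_group G) \<subseteq> carrier (grothendieck_group H)"
      using hom_carrier[OF \<open>h \<in> hom _ _\<close>] .
    show "carrier (grothendieck_group H) \<subseteq> h ` carrier (grothendieck_group G)"
    proof
      fix Y assume "Y \<in> carrier (grothendieck_group H)"
      then obtain c d where "c \<in> carrier H" "d \<in> carrier H" and Y: "Y = H.difference c d"
        by (rule H.differenceE)
      then obtain a b where [simp]: "a \<in> carrier G" "b \<in> carrier G" and "c = f a" "d = f b"
        using surj by blast
      then have "Y = h (G.difference a b)" by (simp add: Y h)
      then show "Y \<in> h ` carrier (grothendieck_group G)"
        using G.difference_closed[of a b] by simp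
    qed
  qed
  ultimately show ?thesis using h that by blast
qed

section \<open>Induced homomorphisms\<close>

lemma (in orthogonally_complete_inverse_semigroup) matrices_orthogonal_copies: "semigroup_with_orthogonal_copies (matrices S)"
  using orthogonally_complete_matrices orthogonal_copy_exists
  by (auto intro!: semigroup_with_orthogonal_copies.intro semigroup_with_orthogonal_copies_axioms.intro)

locale join_preserving_hom =
  S?: orthogonally_complete_inverse_semigroup S + T?: orthogonally_complete_inverse_semigroup T +
  semigroup_zero_hom S T \<phi>
  for S (structure) and T (structure) and \<phi> +
  assumes join_preserving: "orthogonal_join_preserving S T \<phi>"
begin

text \<open>Preservation of binary orthogonal joins extends to finite ones in the same way as their existence: the
join of \<open>A\<close> is orthogonal to any further element.\<close>

lemma hom_lub:
  assumes "finite A" "A \<subseteq> carrier S" "pairwise (orthogonal S) A" "lub S x A"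
  shows "lub T (\<phi> x) (\<phi> ` A)"
  using assms
proof (induction A arbitrary: x)
  case empty
  then have "x = \<bottom>z\<^bsub>S\<^esub>" using S.lub_zero by blast
  moreover have "lub T \<bottom>z\<^bsub>T\<^esub> {}" by (rule T.lubI) auto
  ultimately show ?case by simp
next
  case (insert a A)
  then have A: "finite A" "A \<subseteq> carrier S" "pairwise (orthogonal S) A" and a [simp]: "a \<in> carrier S"
    and o: "\<And>b. b \<in> A \<Longrightarrow> orthogonal S a b"
    by (auto simp: pairwise_insert)
  obtain y where y: "lub S y A" using S.finite_orthogonal_lub_exists[OF A] by blast
  note [simp] = S.lub_closed[OF y]
  have ay: "orthogonal S a y" by (rule S.orthogonal_lub[OF A y a o])
  have "x = S.ojoin a y"
    using insert.prems(3) S.lub_insert[OF y A(2) a] S.join_eq by metis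
  then have "\<phi> x = T.ojoin (\<phi> a) (\<phi> y)"
    using join_preserving ay by (simp add: orthogonal_join_preserving_def)
  then have "lub T (\<phi> x) {\<phi> a, \<phi> y}"
    using T.lub_join[OF _ _ hom_orthogonal[OF ay]] by simp
  moreover have "\<phi> ` A \<subseteq> carrier T" using A(2) by auto
  ultimately show ?case
    using T.lub_insert[OF insert.IH[OF A(2,3) y], of "\<phi> a"] by simp
qed

lemma map_matrix_closed:
  assumes A: "A \<in> carrier (matrices S)"
  shows "map_matrix \<phi> A \<in> carrier (matrices T)"
  unfolding T.matrix_iff map_matrix_def
proof (intro conjI allI impI)
  fix i j k :: nat
  show "\<phi> (A i j) \<in> carrier T" using A by simp
  show "sinv\<^bsub>T\<^esub> (\<phi> (A i j)) \<odot>\<^bsub>T\<^esub> \<phi> (A i k) = \<bottom>z\<^bsub>T\<^esub>" if "j \<noteq> k"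
    using arg_cong[OF S.matrix_row[OF A that, of i], of \<phi>] A by simp
  show "\<phi> (A i k) \<odot>\<^bsub>T\<^esub> sinv\<^bsub>T\<^esub> (\<phi> (A j k)) = \<bottom>z\<^bsub>T\<^esub>" if "i \<noteq> j"
    using arg_cong[OF S.matrix_col[OF A that, of k], of \<phi>] A by simp
next
  have "{(i, j). \<phi> (A i j) \<noteq> \<bottom>z\<^bsub>T\<^esub>} \<subseteq> {(i, j). A i j \<noteq> \<bottom>z\<^bsub>S\<^esub>}" by auto
  then show "finite {(i, j). \<phi> (A i j) \<noteq> \<bottom>z\<^bsub>T\<^esub>}"
    using S.matrix_support[OF A] by (rule finite_subset)
qed

lemma map_matrix_mult:
  assumes A: "A \<in> carrier (matrices S)" and B: "B \<in> carrier (matrices S)"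
  shows "map_matrix \<phi> (A \<odot>\<^bsub>matrices S\<^esub> B) = map_matrix \<phi> A \<odot>\<^bsub>matrices T\<^esub> map_matrix \<phi> B"
proof (intro ext)
  fix i j
  have "lub T (\<phi> ((A \<odot>\<^bsub>matrices S\<^esub> B) i j)) (\<phi> ` range (\<lambda>k. A i k \<odot>\<^bsub>S\<^esub> B k j))"
    using S.product_terms[OF A B] S.mult_lub[OF A B] by (rule hom_lub)
  then have "lub T (map_matrix \<phi> (A \<odot>\<^bsub>matrices S\<^esub> B) i j)
      (range (\<lambda>k. map_matrix \<phi> A i k \<odot>\<^bsub>T\<^esub> map_matrix \<phi> B k j))"
    using A B by (simp add: image_image map_matrix_def)
  then show "map_matrix \<phi> (A \<odot>\<^bsub>matrices S\<^esub> B) i j =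
      (map_matrix \<phi> A \<odot>\<^bsub>matrices T\<^esub> map_matrix \<phi> B) i j"
    by (rule T.lub_unique) (intro T.mult_lub map_matrix_closed A B)
qed

lemma map_matrix_szhom: "map_matrix \<phi> \<in> szhom (matrices S) (matrices T)"
  using map_matrix_closed map_matrix_mult
  by (auto simp: szhom_def S.matrix_szero T.matrix_szero map_matrix_def[of \<phi> "\<lambda>i j. \<bottom>z\<^bsub>S\<^esub>"])

lemma map_matrix_join_preserving:
  "orthogonal_join_preserving (matrices S) (matrices T) (map_matrix \<phi>)"
  unfolding orthogonal_join_preserving_def
proof (intro ballI impI)
  interpret MS: orthogonally_complete_inverse_semigroup "matrices S"
    by (rule S.orthogonally_complete_matrices)
  interpret MT: orthogonally_complete_inverse_semigroup "matrices T"
    by (rule T.orthogonally_complete_matrices)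
  fix A B assume A: "A \<in> carrier (matrices S)" and B: "B \<in> carrier (matrices S)"
    and o: "orthogonal (matrices S) A B"
  let ?X = "A \<squnion>\<^bsub>natural_order (matrices S)\<^esub> B"
  have "pairwise (orthogonal (matrices S)) {A, B}"
    using o MS.orthogonal_sym A B by (auto simp: pairwise_insert)
  then have AB: "finite {A, B}" "{A, B} \<subseteq> carrier (matrices S)"
    "pairwise (orthogonal (matrices S)) {A, B}"
    using A B by auto
  have X: "lub (matrices S) ?X {A, B}" using A B o by (rule MS.lub_join)
  have "lub (matrices T) (map_matrix \<phi> ?X) {map_matrix \<phi> A, map_matrix \<phi> B}"
  proof (rule T.lub_matrixI)
    show "map_matrix \<phi> ?X \<in> carrier (matrices T)"
      by (intro map_matrix_closed MS.lub_closed[OF X])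
    show "{map_matrix \<phi> A, map_matrix \<phi> B} \<subseteq> carrier (matrices T)"
      using A B map_matrix_closed by simp
    fix i j
    have "lub T (\<phi> (?X i j)) (\<phi> ` (\<lambda>A. A i j) ` {A, B})"
      by (rule hom_lub) (rule S.orthogonal_matrices_entries[OF AB] S.orthogonal_lub_entries[OF AB X])+
    then show "lub T (map_matrix \<phi> ?X i j) ((\<lambda>A. A i j) ` {map_matrix \<phi> A, map_matrix \<phi> B})"
      by (simp add: map_matrix_def)
  qed
  then show "map_matrix \<phi> ?X = map_matrix \<phi> A \<squnion>\<^bsub>natural_order (matrices T)\<^esub> map_matrix \<phi> B"
    by (rule MT.join_eq[symmetric])
qed

text \<open>A preimage \<open>s\<close> of an idempotent \<open>f\<close> may be replaced by the idempotent \<open>s\<^sup>-\<^sup>1 s\<close>, which \<open>\<phi>\<close> sends to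
\<open>f\<^sup>-\<^sup>1 f = f\<close>. The zero entries have to be lifted to zero for the diagonal matrix of the lifts to have
finite support.\<close>

lemma map_matrix_idempotents_surj:
  assumes surj: "\<phi> ` carrier S = carrier T" and F: "F \<in> idempotents (matrices T)"
  obtains E where "E \<in> idempotents (matrices S)" "map_matrix \<phi> E = F"
proof -
  have "\<exists>e. e \<in> idempotents S \<and> \<phi> e = F i i \<and> (F i i = \<bottom>z\<^bsub>T\<^esub> \<longrightarrow> e = \<bottom>z\<^bsub>S\<^esub>)" for i
  proof (cases "F i i = \<bottom>z\<^bsub>T\<^esub>")
    case True
    then show ?thesis by (intro exI[of _ "\<bottom>z\<^bsub>S\<^esub>"]) simp
  next
    case False
    have f: "F i i \<in> idempotents T" using F by (rule T.idempotent_matrix_entry)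
    then have "F i i \<in> \<phi> ` carrier S" using surj T.idempotentD(1) by simp
    then obtain s where s: "s \<in> carrier S" "\<phi> s = F i i" by (metis imageE)
    have "\<phi> (sinv\<^bsub>S\<^esub> s \<odot>\<^bsub>S\<^esub> s) = F i i" using s f by (simp add: T.idempotentD)
    then show ?thesis using False s by (intro exI[of _ "sinv\<^bsub>S\<^esub> s \<odot>\<^bsub>S\<^esub> s"]) simp
  qed
  then obtain e where e: "\<And>i. e i \<in> idempotents S" "\<And>i. \<phi> (e i) = F i i"
    "\<And>i. F i i = \<bottom>z\<^bsub>T\<^esub> \<Longrightarrow> e i = \<bottom>z\<^bsub>S\<^esub>"
    by metis
  have Fc: "F \<in> carrier (matrices T)" using F by (simp add: idempotents_def)
  have "{i. e i \<noteq> \<bottom>z\<^bsub>S\<^esub>} \<subseteq> fst ` {(i, j). F i j \<noteq> \<bottom>z\<^bsub>T\<^esub>}"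
  proof
    fix i assume "i \<in> {i. e i \<noteq> \<bottom>z\<^bsub>S\<^esub>}"
    then have "F i i \<noteq> \<bottom>z\<^bsub>T\<^esub>" using e(3) by blast
    then show "i \<in> fst ` {(i, j). F i j \<noteq> \<bottom>z\<^bsub>T\<^esub>}" by (intro image_eqI[of _ fst "(i, i)"]) simp_all
  qed
  then have fin: "finite {i. e i \<noteq> \<bottom>z\<^bsub>S\<^esub>}"
    by (rule finite_subset) (simp add: T.matrix_support[OF Fc])
  let ?E = "\<lambda>i j. if i = j then e i else \<bottom>z\<^bsub>S\<^esub>"
  have "map_matrix \<phi> ?E = F"
  proof (intro ext)
    fix i j
    show "map_matrix \<phi> ?E i j = F i j"
      using T.idempotent_matrix_diagonal[OF F] e(2) unfolding map_matrix_def T.diagonal_def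
      by (cases "i = j") simp_all
  qed
  with S.diagonal_idempotent_matrix[OF e(1) fin] that show ?thesis by blast
qed

end

theorem theorem4p6p3:
  fixes S :: "('a, 's) semigroup_zero_scheme" and T :: "('b, 't) semigroup_zero_scheme"
    and \<phi> :: "'a \<Rightarrow> 'b"
  assumes "orthogonally_complete_inverse_monoid S"
    and "orthogonally_complete_inverse_monoid T"
    and "\<phi> \<in> szhom S T"
    and "orthogonal_join_preserving S T \<phi>"
  shows "\<exists>h. group_hom (K_group S) (K_group T) h \<and>
    (\<forall>E\<in>idempotents (matrices S). map_matrix \<phi> E \<in> idempotents (matrices T) \<and>
       h (K_class S E) = K_class T (map_matrix \<phi> E)) \<and>
    (\<phi> ` carrier S = carrier T \<and> {s \<in> carrier S. \<phi> s = \<bottom>z\<^bsub>T\<^esub>} = {\<bottom>z\<^bsub>S\<^esub>} \<longrightarrow>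
       h ` carrier (K_group S) = carrier (K_group T))"
proof -
  interpret S: orthogonally_complete_inverse_monoid S by fact
  interpret T: orthogonally_complete_inverse_monoid T by fact
  interpret join_preserving_hom S T \<phi> by unfold_locales fact+
  interpret MS: semigroup_with_orthogonal_copies "matrices S" by (rule S.matrices_orthogonal_copies)
  interpret MT: semigroup_with_orthogonal_copies "matrices T" by (rule T.matrices_orthogonal_copies)
  interpret Phi: semigroup_zero_hom "matrices S" "matrices T" "map_matrix \<phi>"
    by unfold_locales (rule map_matrix_szhom)
  let ?G = "idempotent_classes (matrices S)" and ?H = "idempotent_classes (matrices T)"
  obtain f where f: "f \<in> hom ?G ?H"
    and fE: "\<And>E. E \<in> idempotents (matrices S) \<Longrightarrow>
      f (MS.idempotent_class E) = MT.idempotent_class (map_matrix \<phi> E)"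
    using idempotent_classes_functorial[OF S.matrices_orthogonal_copies T.matrices_orthogonal_copies map_matrix_szhom
        map_matrix_join_preserving] by blast
  obtain h where h: "group_hom (K_group S) (K_group T) h"
    and hd: "\<And>a b. \<lbrakk>a \<in> carrier ?G; b \<in> carrier ?G\<rbrakk> \<Longrightarrow>
       h (grothendieck_rel ?G `` {(a, b)}) = grothendieck_rel ?H `` {(f a, f b)}"
    and hsurj: "f ` carrier ?G = carrier ?H \<Longrightarrow> h ` carrier (K_group S) = carrier (K_group T)"
    using grothendieck_group_functorial[OF MS.comm_monoid_idempotent_classes
        MT.comm_monoid_idempotent_classes f] unfolding K_group_def by blast
  have "h (K_class S E) = K_class T (map_matrix \<phi> E)" if "E \<in> idempotents (matrices S)" for E
  proof -
    have "f \<one>\<^bsub>?G\<^esub> = \<one>\<^bsub>?H\<^esub>"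
      using fE[OF MS.zero_idempotent] by (simp add: MS.idempotent_class_one MT.idempotent_class_one)
    then show ?thesis
      unfolding K_class_def using that
      by (subst hd) (simp_all add: fE MS.idempotent_class_closed MS.idempotent_class_one)
  qed
  moreover have "f ` carrier ?G = carrier ?H" if surj: "\<phi> ` carrier S = carrier T"
  proof
    show "f ` carrier ?G \<subseteq> carrier ?H" using f by (rule hom_carrier)
    show "carrier ?H \<subseteq> f ` carrier ?G"
    proof
      fix Y assume "Y \<in> carrier ?H"
      then obtain F where F: "F \<in> idempotents (matrices T)" and Y: "Y = MT.idempotent_class F"
        by (rule MT.idempotent_classE)
      obtain E where "E \<in> idempotents (matrices S)" "map_matrix \<phi> E = F"
        using surj F by (rule map_matrix_idempotents_surj)
      then have "Y = f (MS.idempotent_class E)" "MS.idempotent_class E \<in> carrier ?G"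
        by (simp_all add: Y fE MS.idempotent_class_closed)
      then show "Y \<in> f ` carrier ?G" by (rule image_eqI)
    qed
  qed
  ultimately show ?thesis
    by (intro exI[of _ h] conjI ballI impI h Phi.hom_idempotent hsurj) simp_all
qed

end
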